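(* Let $(\Omega,\mathcal{F})$ be a measurable space, $T:\Omega\to\Omega$ measurable, and $V$ a $T$-invariant upper probability. Then $V$ is weakly mixing if and only if there exists $Q\in\mathcal{M}^{wm}(T)\cap\operatorname{core}(V)$ such that for every $P\in\operatorname{core}(V)$, $P(A)=Q(A)$ for all $A\in\mathcal{I}$. Moreover, such a $Q$ is unique.
   Context: A capacity is a monotone map $\mu:\mathcal{F}\to[0,1]$ with $\mu(\emptyset)=0,\mu(\Omega)=1$. An upper probability is a capacity $V$ with $V(A)=\max_{P\in\Lambda}P(A)$ for a weak* (setwise convergence) compact set $\Lambda$ of probabilities; $\operatorname{core}(V)$ is the set of finitely additive normalized $P\le V$. $V$ is $T$-invariant if $V(T^{-1}A)=V(A)$ for all $A$; $\mathcal{I}=\{A:T^{-1}A=A\}$. A $T$-invariant capacity $\mu$ is weakly mixing if every $\mathcal{F}$-measurable $f:\Omega\to\mathbb{C}$ satisfying $f\circ T=\lambda f$ $\mu$-a.s. for some $\lambda\in\mathbb{C}$ is constant $\mu$-a.s. (a property holds $\mu$-a.s. if it holds on $A\in\mathcal{F}$ with $\mu(A^c)=0$). $\mathcal{M}^{wm}(T)$ is the set of $T$-invariant probabilities $P$ that are weakly mixing, i.e. $P\times P$ is ergodic for $T\times T$ (every $T\times T$-invariant set has $P\times P$-measure $0$ or $1$). *)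

theory Defs
  imports "HOL-Probability.Probability"
begin

text \<open>Set functions on the measurable space (space M, sets M) are represented as
  functions of type 'a set => real that vanish outside sets M.
  Preimage under T inside Omega: T -` A \<inter> space M.\<close>

definition prob_fun :: "'a measure \<Rightarrow> ('a set \<Rightarrow> real) \<Rightarrow> bool" where
  "prob_fun M P \<longleftrightarrow>
     (\<forall>A. A \<notin> sets M \<longrightarrow> P A = 0) \<and>
     (\<forall>A\<in>sets M. 0 \<le> P A) \<and> P (space M) = 1 \<and>
     (\<forall>F. range F \<subseteq> sets M \<longrightarrow> disjoint_family F \<longrightarrow> (\<lambda>n. P (F n)) sums P (\<Union>(range F)))"

text \<open>Upper probability: V(A) = max over a compact (setwise convergence = product
  topology) set of probabilities.\<close>
definition upper_prob :: "'a measure \<Rightarrow> ('a set \<Rightarrow> real) \<Rightarrow> bool" where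
  "upper_prob M V \<longleftrightarrow>
     (\<exists>\<Lambda>. \<Lambda> \<subseteq> {P. prob_fun M P} \<and> compact \<Lambda> \<and>
        (\<forall>A\<in>sets M. (\<forall>P\<in>\<Lambda>. P A \<le> V A) \<and> (\<exists>P\<in>\<Lambda>. P A = V A)))"

definition core :: "'a measure \<Rightarrow> ('a set \<Rightarrow> real) \<Rightarrow> ('a set \<Rightarrow> real) set" where
  "core M V = {P.
     (\<forall>A. A \<notin> sets M \<longrightarrow> P A = 0) \<and>
     (\<forall>A\<in>sets M. 0 \<le> P A) \<and> P (space M) = 1 \<and>
     (\<forall>A\<in>sets M. \<forall>B\<in>sets M. A \<inter> B = {} \<longrightarrow> P (A \<union> B) = P A + P B) \<and>
     (\<forall>A\<in>sets M. P A \<le> V A)}"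

definition T_invariant_fun :: "'a measure \<Rightarrow> ('a \<Rightarrow> 'a) \<Rightarrow> ('a set \<Rightarrow> real) \<Rightarrow> bool" where
  "T_invariant_fun M T \<mu> \<longleftrightarrow> (\<forall>A\<in>sets M. \<mu> (T -` A \<inter> space M) = \<mu> A)"

definition inv_sets :: "'a measure \<Rightarrow> ('a \<Rightarrow> 'a) \<Rightarrow> 'a set set" where
  "inv_sets M T = {A \<in> sets M. T -` A \<inter> space M = A}"

definition cap_ae :: "'a measure \<Rightarrow> ('a set \<Rightarrow> real) \<Rightarrow> ('a \<Rightarrow> bool) \<Rightarrow> bool" where
  "cap_ae M \<mu> Prop \<longleftrightarrow> (\<exists>A\<in>sets M. \<mu> (space M - A) = 0 \<and> (\<forall>x\<in>A. Prop x))"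

definition cap_weakly_mixing :: "'a measure \<Rightarrow> ('a \<Rightarrow> 'a) \<Rightarrow> ('a set \<Rightarrow> real) \<Rightarrow> bool" where
  "cap_weakly_mixing M T \<mu> \<longleftrightarrow>
     (\<forall>f :: 'a \<Rightarrow> complex. f \<in> borel_measurable M \<longrightarrow>
        (\<forall>c. cap_ae M \<mu> (\<lambda>x. f (T x) = c * f x) \<longrightarrow> (\<exists>k. cap_ae M \<mu> (\<lambda>x. f x = k))))"

definition fun_measure :: "'a measure \<Rightarrow> ('a set \<Rightarrow> real) \<Rightarrow> 'a measure" where
  "fun_measure M P = measure_of (space M) (sets M) (\<lambda>A. ennreal (P A))"

definition Mwm :: "'a measure \<Rightarrow> ('a \<Rightarrow> 'a) \<Rightarrow> ('a set \<Rightarrow> real) set" where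
  "Mwm M T = {P. prob_fun M P \<and> T_invariant_fun M T P \<and>
     (let PP = fun_measure M P \<Otimes>\<^sub>M fun_measure M P in
       \<forall>C\<in>sets PP. map_prod T T -` C \<inter> space PP = C \<longrightarrow>
         measure PP C = 0 \<or> measure PP C = 1)}"

end

theory Submission
  imports Defs "Jordan_Normal_Form.Spectral_Radius"
begin

text \<open>
  All elements of the core are countably additive, since \<open>V\<close> is continuous at the empty set.
  If \<open>V\<close> is weakly mixing, then \<open>V\<close> is 0-1 on invariant sets, so the core is constant there; a
  cluster point of Cesaro averages gives an invariant \<open>Q\<close> in the core. Suppose \<open>Q \<times> Q\<close> is not
  ergodic. An invariant set of the product, centred and composed with its transpose, is a nonzero
  symmetric \<open>T \<times> T\<close>-invariant kernel with mean zero. Normalised even powers of this kernel converge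
  (power iteration) to the kernel \<open>p\<close> of an orthogonal projection of finite rank. Because the limit
  exists at every point, not only almost everywhere, the range of \<open>p\<close> is a finite-dimensional space
  of genuine functions invariant under composition with \<open>T\<close>; an eigenvector there satisfies
  \<open>w \<circ> T = r w\<close> everywhere, so it is an eigenfunction for \<open>V\<close> and not only for \<open>Q\<close>, and it is
  not constant: contradiction.

  Conversely, if \<open>f \<circ> T = c f\<close> with \<open>c \<noteq> 0\<close>, then \<open>f x / f y\<close> is \<open>T \<times> T\<close>-invariant, hence
  constant for \<open>Q \<times> Q\<close>, so \<open>f\<close> equals a constant \<open>Q\<close>-almost surely; the set of points on whose
  orbit \<open>f\<close> is eventually equal to this constant is invariant, so it has full measure under the
  whole core.
\<close>

section \<open>Log-convex sequences and eigenvectors\<close>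

text \<open>A set that is null for \<open>Q\<close> may have positive \<open>V\<close>, so an
  eigenfunction known only up to \<open>Q\<close>-null sets, which is what spectral theory in L2
  supplies, says nothing about \<open>V\<close>. Hence every object is controlled at each point of
  the space. Convergence of the powers comes from the diagonal: for an even power the value at (x,
  x) is the squared norm of a section. As the exponent grows these values are log-convex, and they
  are submultiplicative against the traces. These two properties force one growth rate
  \<open>l\<close>, the square of the operator norm, to bound the diagonal at all x at once. After
  division by powers of \<open>l\<close> the diagonal decreases, and Cauchy-Schwarz handles the
  points off the diagonal. The traces are at least the corresponding powers of \<open>l\<close>, so
  the limit does not vanish; its own trace is finite and bounds the dimension of its range. In the
  converse, members of the core other than \<open>Q\<close> need not be invariant under T, so null
  sets are moved along orbits by means of \<open>V\<close>, which is invariant.\<close>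

lemma log_convex_ratio_le:
  fixes s :: "nat \<Rightarrow> real"
  assumes convex: "\<And>n. (s (Suc n))\<^sup>2 \<le> s n * s (Suc (Suc n))"
    and pos: "0 < s n" "0 < s (Suc n)"
  shows "(s (Suc n) / s n) ^ j * s n \<le> s (n + j)"
proof -
  define r where "r = s (Suc n) / s n"
  have r: "0 < r" using pos by (simp add: r_def)
  \<comment> \<open>Log-convexity says that ratios of consecutive terms do not decrease. Positivity
    is carried along in the same induction so that \<open>s (n + j)\<close> can be
    cancelled.\<close>
  have step: "0 < s (n + j) \<and> r * s (n + j) \<le> s (Suc (n + j))" for j
  proof (induction j)
    case 0
    then show ?case using pos by (simp add: r_def)
  next
    case (Suc j)
    then have p: "0 < s (n + j)" and q: "r * s (n + j) \<le> s (Suc (n + j))" by auto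
    have p': "0 < s (Suc (n + j))" using q p r by (meson less_le_trans mult_pos_pos)
    have "s (n + j) * (r * s (Suc (n + j))) = (r * s (n + j)) * s (Suc (n + j))" by simp
    also have "\<dots> \<le> s (Suc (n + j)) * s (Suc (n + j))"
      using q p' by (intro mult_right_mono) auto
    also have "\<dots> \<le> s (n + j) * s (Suc (Suc (n + j)))"
      using convex[of "n + j"] by (simp add: power2_eq_square)
    finally show ?case using p p' by simp
  qed
  have "r ^ j * s n \<le> s (n + j)"
  proof (induction j)
    case (Suc j)
    have "r ^ Suc j * s n = r * (r ^ j * s n)" by simp
    also have "\<dots> \<le> r * s (n + j)" using Suc r by (intro mult_left_mono) auto
    also have "\<dots> \<le> s (n + Suc j)" using step[of j] by simp
    finally show ?case .
  qed simp
  then show ?thesis by (simp add: r_def)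
qed

text \<open>Log-convexity makes the ratios \<open>a (Suc n) / a n\<close> increase and
  submultiplicativity bounds them by \<open>a 0\<close>, so their supremum \<open>l\<close> bounds
  each step from above and, through its powers, each term from below. The extra \<open>Suc\<close>
  in \<open>sub\<close> arises because the entry of index \<open>n\<close> belongs to the power
  \<open>n + 1\<close>.\<close>

lemma submultiplicative_log_convex_rate:
  fixes a :: "nat \<Rightarrow> real"
  assumes pos: "\<And>n. 0 < a n"
    and sub: "\<And>m n. a (Suc (m + n)) \<le> a m * a n"
    and convex: "\<And>n. (a (Suc n))\<^sup>2 \<le> a n * a (Suc (Suc n))"
  obtains l where "0 < l" "\<And>n. a (Suc n) \<le> l * a n" "\<And>n. l ^ Suc n \<le> a n"
proof -
  define r where "r n = a (Suc n) / a n" for n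
  have r_pos: "0 < r n" for n using pos by (simp add: r_def)
  have r_pow: "r n ^ Suc m \<le> a m" for n m
  proof -
    have "r n ^ Suc m * a n \<le> a (n + Suc m)"
      unfolding r_def by (rule log_convex_ratio_le) (use convex pos in auto)
    also have "\<dots> \<le> a m * a n" using sub[of n m] by (simp add: mult.commute)
    finally show ?thesis using pos[of n] by simp
  qed
  have bdd: "bdd_above (range r)"
    using r_pow[of _ 0] by (intro bdd_aboveI[of _ "a 0"]) auto
  define l where "l = (SUP n. r n)"
  have r_le: "r n \<le> l" for n unfolding l_def by (rule cSUP_upper) (auto simp: bdd)
  have l_pos: "0 < l" using r_pos[of 0] r_le[of 0] by linarith
  have "l ^ Suc m \<le> a m" for m
  proof -
    have "r n \<le> root (Suc m) (a m)" for n
      using r_pow[of n m] r_pos[of n]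
      by (metis less_eq_real_def real_root_le_iff real_root_power_cancel zero_less_Suc)
    then have "l \<le> root (Suc m) (a m)"
      unfolding l_def by (intro cSUP_least) auto
    then have "l ^ Suc m \<le> root (Suc m) (a m) ^ Suc m"
      using l_pos by (intro power_mono) auto
    then show ?thesis
      using real_root_pow_pos2[of "Suc m" "a m"] pos[of m] by linarith
  qed
  moreover have "a (Suc n) \<le> l * a n" for n
    using r_le[of n] pos[of n] by (simp add: r_def field_simps)
  ultimately show ?thesis using that l_pos by blast
qed

text \<open>A single ratio \<open>q\<close> above \<open>l\<close> would, by log-convexity, force
  growth like \<open>q ^ j\<close> ever after, while \<open>sub\<close> and the rate of
  \<open>a\<close> allow at most growth like \<open>l ^ j\<close>. With traces for \<open>a\<close>
  and the diagonal at one point for \<open>s\<close>, this gives all points the same rate.\<close>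

lemma log_convex_le_of_rate:
  fixes s a :: "nat \<Rightarrow> real"
  assumes nonneg: "\<And>n. 0 \<le> s n"
    and convex: "\<And>n. (s (Suc n))\<^sup>2 \<le> s n * s (Suc (Suc n))"
    and sub: "\<And>m n. s (Suc (m + n)) \<le> s m * a n"
    and l: "0 < l" "\<And>n. a (Suc n) \<le> l * a n"
  shows "s (Suc n) \<le> l * s n"
proof (rule ccontr)
  assume *: "\<not> s (Suc n) \<le> l * s n"
  have p': "0 < s (Suc n)" using * nonneg[of n] l(1)
    by (smt (verit) mult_nonneg_nonneg)
  have p: "0 < s n"
  proof (rule ccontr)
    assume "\<not> 0 < s n"
    then have "s n = 0" using nonneg[of n] by simp
    then show False using sub[of n 0] p' by simp
  qed
  define q where "q = s (Suc n) / s n"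
  have ql: "l < q" using * p by (simp add: q_def field_simps)
  have a_le: "a j \<le> l ^ j * a 0" for j
  proof (induction j)
    case (Suc j)
    have "a (Suc j) \<le> l * a j" by (rule l)
    also have "\<dots> \<le> l * (l ^ j * a 0)" using Suc l by simp
    finally show ?case by simp
  qed simp
  have "(q / l) ^ j * q \<le> a 0" for j
  proof -
    have "q ^ Suc j * s n \<le> s (n + Suc j)"
      unfolding q_def by (rule log_convex_ratio_le) (use convex p p' in auto)
    also have "\<dots> \<le> s n * a j" using sub[of n j] by simp
    also have "\<dots> \<le> s n * (l ^ j * a 0)" using p a_le by simp
    finally have "q ^ Suc j \<le> l ^ j * a 0" using p by simp
    then show ?thesis using l(1) by (simp add: field_simps)
  qed
  moreover obtain j where "a 0 / q < (q / l) ^ j"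
    using real_arch_pow[of "q / l"] ql l(1) by auto
  ultimately show False using ql l(1)
    by (smt (verit) divide_less_eq)
qed

text \<open>Nonemptiness of the complex spectrum, restated for plain functions on the indices below
  \<open>N\<close>. This is where complex numbers enter: all kernels are real, but the action of T
  on their range may have no real eigenvalue.\<close>

lemma complex_matrix_has_eigenvector:
  fixes A :: "nat \<Rightarrow> nat \<Rightarrow> complex"
  assumes "0 < N"
  obtains v r where "\<exists>i<N. v i \<noteq> 0" "\<And>i. i < N \<Longrightarrow> (\<Sum>j<N. A i j * v j) = r * v i"
proof -
  define B where "B = mat N N (\<lambda>(i, j). A i j)"
  have B: "B \<in> carrier_mat N N" by (simp add: B_def)
  from spectrum_non_empty[OF B assms] obtain r where "eigenvalue B r"
    by (auto simp: spectrum_def)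
  then obtain u where u: "u \<in> carrier_vec N" "u \<noteq> 0\<^sub>v N" "B *\<^sub>v u = r \<cdot>\<^sub>v u"
    using B by (auto simp: eigenvalue_def eigenvector_def)
  have "\<exists>i<N. vec_index u i \<noteq> 0"
  proof (rule ccontr)
    assume "\<not> ?thesis"
    then have "u = 0\<^sub>v N" using u(1) by (intro eq_vecI) auto
    with u(2) show False by simp
  qed
  moreover have "(\<Sum>j<N. A i j * vec_index u j) = r * vec_index u i" if "i < N" for i
  proof -
    have "vec_index (B *\<^sub>v u) i = (\<Sum>j<N. A i j * vec_index u j)"
      using that u(1) by (simp add: B_def scalar_prod_def atLeast0LessThan)
    then show ?thesis using u that by simp
  qed
  ultimately show ?thesis using that by blast
qed

section \<open>Bounded kernels\<close>

text \<open>The bound holds at every point, not almost everywhere, so that every section of a kernel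
  is integrable and identities between integrals hold without exceptional sets.\<close>

definition bdd_fun :: "'a measure \<Rightarrow> ('a \<Rightarrow> real) \<Rightarrow> bool" where
  "bdd_fun M f \<longleftrightarrow> f \<in> borel_measurable M \<and> (\<exists>B. \<forall>x\<in>space M. \<bar>f x\<bar> \<le> B)"

definition bdd_kernel :: "'a measure \<Rightarrow> ('a \<Rightarrow> 'a \<Rightarrow> real) \<Rightarrow> bool" where
  "bdd_kernel M K \<longleftrightarrow> bdd_fun (M \<Otimes>\<^sub>M M) (\<lambda>(x, y). K x y)"

lemma bdd_funI: "f \<in> borel_measurable M \<Longrightarrow> (\<And>x. x \<in> space M \<Longrightarrow> \<bar>f x\<bar> \<le> B) \<Longrightarrow> bdd_fun M f"
  by (auto simp: bdd_fun_def)

lemma bdd_fun_measurable: "bdd_fun M f \<Longrightarrow> f \<in> borel_measurable M"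
  by (simp add: bdd_fun_def)

lemma bdd_fun_bound:
  assumes "bdd_fun M f"
  shows "\<exists>B\<ge>0. \<forall>x\<in>space M. \<bar>f x\<bar> \<le> B"
proof -
  from assms obtain B where "\<forall>x\<in>space M. \<bar>f x\<bar> \<le> B" by (auto simp: bdd_fun_def)
  then have "\<forall>x\<in>space M. \<bar>f x\<bar> \<le> max 0 B" by (auto simp: le_max_iff_disj)
  then show ?thesis by (intro exI[of _ "max 0 B"]) auto
qed

lemma bdd_fun_const: "bdd_fun M (\<lambda>x. c)"
  by (auto simp: bdd_fun_def)

lemma bdd_fun_add:
  assumes "bdd_fun M f" "bdd_fun M g" shows "bdd_fun M (\<lambda>x. f x + g x)"
proof -
  obtain A where A: "0 \<le> A" "\<forall>x\<in>space M. \<bar>f x\<bar> \<le> A"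
    using bdd_fun_bound assms(1) by blast
  obtain B where B: "0 \<le> B" "\<forall>x\<in>space M. \<bar>g x\<bar> \<le> B"
    using bdd_fun_bound assms(2) by blast
  show ?thesis using assms[THEN bdd_fun_measurable] A B
    by (intro bdd_funI[of _ _ "A + B"]) (auto intro: order_trans[OF abs_triangle_ineq add_mono])
qed

lemma bdd_fun_mult:
  assumes "bdd_fun M f" "bdd_fun M g" shows "bdd_fun M (\<lambda>x. f x * g x)"
proof -
  obtain A where A: "0 \<le> A" "\<forall>x\<in>space M. \<bar>f x\<bar> \<le> A"
    using bdd_fun_bound assms(1) by blast
  obtain B where B: "0 \<le> B" "\<forall>x\<in>space M. \<bar>g x\<bar> \<le> B"
    using bdd_fun_bound assms(2) by blast
  show ?thesis using assms[THEN bdd_fun_measurable] A B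
    by (intro bdd_funI[of _ _ "A * B"]) (auto simp: abs_mult intro: mult_mono)
qed

lemma bdd_fun_diff:
  assumes "bdd_fun M f" "bdd_fun M g" shows "bdd_fun M (\<lambda>x. f x - g x)"
  using bdd_fun_add[OF assms(1) bdd_fun_mult[OF bdd_fun_const[of _ "-1"] assms(2)]] by simp

lemma bdd_fun_divide: "bdd_fun M f \<Longrightarrow> bdd_fun M (\<lambda>x. f x / c)"
  using bdd_fun_mult[OF _ bdd_fun_const[of _ "1 / c"]] by simp

lemma bdd_fun_power2: "bdd_fun M f \<Longrightarrow> bdd_fun M (\<lambda>x. (f x)\<^sup>2)"
  by (simp add: power2_eq_square bdd_fun_mult)

lemma bdd_fun_sum: "(\<And>i. i \<in> I \<Longrightarrow> bdd_fun M (f i)) \<Longrightarrow> bdd_fun M (\<lambda>x. \<Sum>i\<in>I. f i x)"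
  by (induction I rule: infinite_finite_induct) (auto intro: bdd_fun_const bdd_fun_add)

lemma bdd_fun_indicator: "A \<in> sets M \<Longrightarrow> bdd_fun M (indicator A)"
  by (intro bdd_funI[of _ _ 1]) (auto simp: indicator_def)

lemma bdd_fun_sqrt:
  assumes "bdd_fun M f" shows "bdd_fun M (\<lambda>x. sqrt (f x))"
proof -
  obtain A where A: "0 \<le> A" "\<forall>x\<in>space M. \<bar>f x\<bar> \<le> A"
    using bdd_fun_bound assms(1) by blast
  have "\<bar>sqrt (f x)\<bar> \<le> sqrt A" if "x \<in> space M" for x
  proof -
    have "sqrt (f x) \<le> sqrt A" "sqrt (- A) \<le> sqrt (f x)"
      using A(2)[rule_format, OF that] by (intro real_sqrt_le_mono; linarith)+
    then show ?thesis by (simp add: real_sqrt_minus abs_le_iff)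
  qed
  then show ?thesis using bdd_fun_measurable[OF assms]
    by (intro bdd_funI[of _ _ "sqrt A"]) auto
qed

lemma bdd_fun_compose:
  assumes "bdd_fun M f" "T \<in> N \<rightarrow>\<^sub>M M" shows "bdd_fun N (\<lambda>x. f (T x))"
proof -
  obtain A where A: "0 \<le> A" "\<forall>x\<in>space M. \<bar>f x\<bar> \<le> A"
    using bdd_fun_bound assms(1) by blast
  with A show ?thesis using bdd_fun_measurable[OF assms(1)] measurable_space[OF assms(2)] assms(2)
    by (intro bdd_funI[of _ _ A]) auto
qed

lemmas bdd_fun_intros = bdd_fun_const bdd_fun_add bdd_fun_mult bdd_fun_diff bdd_fun_divide
  bdd_fun_power2 bdd_fun_sum bdd_fun_indicator bdd_fun_sqrt

lemma bdd_kernelD: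
  assumes "bdd_kernel M K" "f \<in> N \<rightarrow>\<^sub>M M" "g \<in> N \<rightarrow>\<^sub>M M"
  shows "bdd_fun N (\<lambda>w. K (f w) (g w))"
  using bdd_fun_compose[OF assms(1)[unfolded bdd_kernel_def], of "\<lambda>w. (f w, g w)" N] assms(2,3)
  by simp

lemma bdd_kernel_section:
  assumes "bdd_kernel M K" "x \<in> space M"
  shows "bdd_fun M (K x)" "bdd_fun M (\<lambda>y. K y x)"
proof -
  show "bdd_fun M (K x)"
    by (rule bdd_kernelD[OF assms(1), where f = "\<lambda>_. x" and g = "\<lambda>y. y"]) (use assms(2) in auto)
  show "bdd_fun M (\<lambda>y. K y x)"
    by (rule bdd_kernelD[OF assms(1), where f = "\<lambda>y. y" and g = "\<lambda>_. x"]) (use assms(2) in auto)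
qed

lemma bdd_kernel_mult: "bdd_kernel M K \<Longrightarrow> bdd_kernel M L \<Longrightarrow> bdd_kernel M (\<lambda>x y. K x y * L x y)"
  unfolding bdd_kernel_def case_prod_unfold by (rule bdd_fun_mult)

lemma bdd_kernel_diff: "bdd_kernel M K \<Longrightarrow> bdd_kernel M L \<Longrightarrow> bdd_kernel M (\<lambda>x y. K x y - L x y)"
  unfolding bdd_kernel_def case_prod_unfold by (rule bdd_fun_diff)

lemma bdd_kernel_fst: "bdd_fun M f \<Longrightarrow> bdd_kernel M (\<lambda>x y. f x)"
  unfolding bdd_kernel_def case_prod_unfold by (rule bdd_fun_compose) auto

lemma bdd_kernel_snd: "bdd_fun M f \<Longrightarrow> bdd_kernel M (\<lambda>x y. f y)"
  unfolding bdd_kernel_def case_prod_unfold by (rule bdd_fun_compose) auto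

lemma bdd_kernel_transpose: "bdd_kernel M K \<Longrightarrow> bdd_kernel M (\<lambda>x y. K y x)"
  using bdd_kernelD[of M K snd "M \<Otimes>\<^sub>M M" fst] by (simp add: bdd_kernel_def case_prod_unfold)

section \<open>Composition of kernels and the Cauchy-Schwarz inequality\<close>

definition kernel_comp :: "'a measure \<Rightarrow> ('a \<Rightarrow> 'a \<Rightarrow> real) \<Rightarrow> ('a \<Rightarrow> 'a \<Rightarrow> real) \<Rightarrow> 'a \<Rightarrow> 'a \<Rightarrow> real" where
  "kernel_comp M K L x y = (\<integral>z. K x z * L z y \<partial>M)"

context prob_space
begin

lemma bdd_fun_integrable: "bdd_fun M f \<Longrightarrow> integrable M f"
  unfolding bdd_fun_def using integrable_const_bound[of f] by (auto intro: AE_I2)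

lemma abs_integral_le_const:
  fixes f :: "'a \<Rightarrow> real"
  assumes "f \<in> borel_measurable M" "\<And>x. x \<in> space M \<Longrightarrow> \<bar>f x\<bar> \<le> B"
  shows "\<bar>\<integral>x. f x \<partial>M\<bar> \<le> B"
proof -
  have i: "integrable M f" using assms by (intro integrable_const_bound[of _ B]) auto
  have "\<bar>\<integral>x. f x \<partial>M\<bar> \<le> (\<integral>x. \<bar>f x\<bar> \<partial>M)" by simp
  also have "\<dots> \<le> (\<integral>x. B \<partial>M)" using i assms by (intro integral_mono) auto
  finally show ?thesis by (simp add: prob_space)
qed

lemma bdd_fun_integral:
  assumes "bdd_fun (N \<Otimes>\<^sub>M M) (\<lambda>(x, y). K x y)"
  shows "bdd_fun N (\<lambda>x. \<integral>y. K x y \<partial>M)"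
proof -
  obtain B where B: "\<forall>p\<in>space (N \<Otimes>\<^sub>M M). \<bar>case p of (x, y) \<Rightarrow> K x y\<bar> \<le> B"
    using bdd_fun_bound[OF assms] by blast
  have [measurable]: "(\<lambda>(x, y). K x y) \<in> borel_measurable (N \<Otimes>\<^sub>M M)"
    using assms by (rule bdd_fun_measurable)
  show ?thesis
  proof (rule bdd_funI[of _ _ B])
    show "(\<lambda>x. \<integral>y. K x y \<partial>M) \<in> borel_measurable N" by measurable
    show "\<bar>\<integral>y. K x y \<partial>M\<bar> \<le> B" if "x \<in> space N" for x
      using that B by (intro abs_integral_le_const) (auto simp: space_pair_measure)
  qed
qed

lemma bdd_kernel_comp:
  assumes "bdd_kernel M K" "bdd_kernel M L" shows "bdd_kernel M (kernel_comp M K L)"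
  unfolding bdd_kernel_def kernel_comp_def case_prod_unfold
proof (rule bdd_fun_integral)
  show "bdd_fun ((M \<Otimes>\<^sub>M M) \<Otimes>\<^sub>M M) (\<lambda>(p, z). K (fst p) z * L z (snd p))"
    unfolding case_prod_unfold using assms by (intro bdd_fun_mult bdd_kernelD[of M]) auto
qed

lemma bdd_kernel_Fubini:
  assumes "bdd_kernel M K"
  shows "(\<integral>x. \<integral>y. K x y \<partial>M \<partial>M) = (\<integral>y. \<integral>x. K x y \<partial>M \<partial>M)"
proof -
  interpret P: pair_prob_space M M ..
  have "integrable (M \<Otimes>\<^sub>M M) (\<lambda>(x, y). K x y)"
    using assms by (intro P.bdd_fun_integrable) (simp add: bdd_kernel_def)
  from P.Fubini_integral[OF this] show ?thesis by simp
qed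

lemma bdd_kernel_integral:
  assumes "bdd_kernel M K"
  shows "bdd_fun M (\<lambda>x. \<integral>y. K x y \<partial>M)"
  using assms bdd_fun_integral by (simp add: bdd_kernel_def)

text \<open>Fubini with both endpoints fixed, which is why the identity holds at every pair of
  points.\<close>

lemma kernel_comp_assoc:
  assumes K: "bdd_kernel M K" and L: "bdd_kernel M L" and J: "bdd_kernel M J"
    and x: "x \<in> space M" and y: "y \<in> space M"
  shows "kernel_comp M (kernel_comp M K L) J x y = kernel_comp M K (kernel_comp M L J) x y"
proof -
  note sec = bdd_kernel_section[OF K x] bdd_kernel_section[OF J y]
  have "bdd_kernel M (\<lambda>z w. K x w * L w z * J z y)"
    by (intro bdd_kernel_mult bdd_kernel_snd[of M "K x"] bdd_kernel_transpose[OF L]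
        bdd_kernel_fst[of M "\<lambda>z. J z y"] sec)
  from bdd_kernel_Fubini[OF this] show ?thesis
    by (simp add: kernel_comp_def mult.assoc flip: integral_mult_right_zero integral_mult_left_zero)
qed

lemma bdd_fun_Cauchy_Schwarz:
  assumes f: "bdd_fun M f" and g: "bdd_fun M g"
  shows "(\<integral>x. f x * g x \<partial>M)\<^sup>2 \<le> (\<integral>x. (f x)\<^sup>2 \<partial>M) * (\<integral>x. (g x)\<^sup>2 \<partial>M)"
proof -
  define A B C where "A = (\<integral>x. (f x)\<^sup>2 \<partial>M)" and "B = (\<integral>x. f x * g x \<partial>M)"
    and "C = (\<integral>x. (g x)\<^sup>2 \<partial>M)"
  have quad: "0 \<le> A - 2 * t * B + t\<^sup>2 * C" for t
  proof -
    have "0 \<le> (\<integral>x. (f x - t * g x)\<^sup>2 \<partial>M)" by simp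
    also have "\<dots> = (\<integral>x. (f x)\<^sup>2 - 2 * t * (f x * g x) + t\<^sup>2 * (g x)\<^sup>2 \<partial>M)"
      by (intro Bochner_Integration.integral_cong) (auto simp: power2_eq_square algebra_simps)
    also have "\<dots> = A - 2 * t * B + t\<^sup>2 * C"
    proof -
      have "integrable M (\<lambda>x. (f x)\<^sup>2)" "integrable M (\<lambda>x. f x * g x)" "integrable M (\<lambda>x. (g x)\<^sup>2)"
        by (intro bdd_fun_integrable bdd_fun_intros f g)+
      then show ?thesis by (simp add: A_def B_def C_def)
    qed
    finally show ?thesis .
  qed
  have "B\<^sup>2 \<le> A * C"
  proof (cases "C = 0")
    case True
    have "B = 0"
    proof (rule ccontr)
      assume "B \<noteq> 0"
      \<comment> \<open>With \<open>C = 0\<close> this value of t makes the quadratic expression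
        equal to -1.\<close>
      with quad[of "(A + 1) / (2 * B)"] True show False by simp
    qed
    then show ?thesis using True by simp
  next
    case False
    then have "C > 0" by (simp add: C_def order_less_le)
    then show ?thesis using quad[of "B / C"] by (simp add: field_simps power2_eq_square)
  qed
  then show ?thesis by (simp add: A_def B_def C_def)
qed

end

text \<open>For a bounded kernel this says that it is zero almost everywhere for the product
  measure, or that its integral operator is zero. Testing on rectangles expresses it through
  iterated integrals alone.\<close>

definition rect_null :: "'a measure \<Rightarrow> ('a \<Rightarrow> 'a \<Rightarrow> real) \<Rightarrow> bool" where
  "rect_null M K \<longleftrightarrow> (\<forall>A\<in>sets M. \<forall>B\<in>sets M.
     (\<integral>x. indicator A x * (\<integral>y. K x y * indicator B y \<partial>M) \<partial>M) = 0)"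

context prob_space
begin

text \<open>The hypothesis says that the operator of \<open>K\<close> composed with its adjoint is
  zero. The squared norm of \<open>u\<close>, the adjoint applied to the indicator of
  \<open>A\<close>, is the pairing of that indicator with its image under the composition, hence
  zero.\<close>

lemma rect_null_of_comp_transpose:
  assumes K: "bdd_kernel M K" and null: "rect_null M (\<lambda>x y. \<integral>z. K x z * K y z \<partial>M)"
  shows "rect_null M K"
  unfolding rect_null_def
proof (intro ballI)
  fix A B assume A: "A \<in> sets M" and B: "B \<in> sets M"
  define u where "u z = (\<integral>x. indicator A x * K x z \<partial>M)" for z
  have iK: "bdd_kernel M (\<lambda>x y. indicator A x * K x y)"
    by (intro bdd_kernel_mult bdd_kernel_fst bdd_fun_indicator K A)
  have u: "bdd_fun M u"
    unfolding u_def using bdd_kernel_integral[OF bdd_kernel_transpose[OF iK]] .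
  have inner: "(\<integral>z. K x z * u z \<partial>M) = (\<integral>y. (\<integral>z. K x z * K y z \<partial>M) * indicator A y \<partial>M)"
    if x: "x \<in> space M" for x
  proof -
    have "bdd_kernel M (\<lambda>z y. K x z * (indicator A y * K y z))"
      by (intro bdd_kernel_mult bdd_kernel_transpose[OF K] bdd_kernel_snd[of M "indicator A"]
          bdd_fun_indicator A bdd_kernel_fst[of M "K x"] bdd_kernel_section[OF K x])
    from bdd_kernel_Fubini[OF this] show ?thesis
      by (simp add: u_def ac_simps flip: integral_mult_right_zero)
  qed
  have "(\<integral>z. (u z)\<^sup>2 \<partial>M) = (\<integral>z. \<integral>x. indicator A x * K x z * u z \<partial>M \<partial>M)"
    by (simp add: u_def power2_eq_square)
  also have "\<dots> = (\<integral>x. \<integral>z. indicator A x * K x z * u z \<partial>M \<partial>M)"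
    by (rule bdd_kernel_Fubini[symmetric]) (intro bdd_kernel_mult iK bdd_kernel_snd u)
  also have "\<dots> = (\<integral>x. indicator A x * (\<integral>z. K x z * u z \<partial>M) \<partial>M)"
    by (simp add: mult.assoc)
  also have "\<dots> = (\<integral>x. indicator A x * (\<integral>y. (\<integral>z. K x z * K y z \<partial>M) * indicator A y \<partial>M) \<partial>M)"
    by (intro Bochner_Integration.integral_cong refl) (simp add: inner)
  also have "\<dots> = 0" using null A by (simp add: rect_null_def)
  finally have u0: "(\<integral>z. (u z)\<^sup>2 \<partial>M) = 0" .
  have "(\<integral>x. indicator A x * (\<integral>y. K x y * indicator B y \<partial>M) \<partial>M)
      = (\<integral>x. \<integral>y. indicator A x * K x y * indicator B y \<partial>M \<partial>M)"
    by (simp add: mult.assoc)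
  also have "\<dots> = (\<integral>y. \<integral>x. indicator A x * K x y * indicator B y \<partial>M \<partial>M)"
    by (rule bdd_kernel_Fubini) (intro bdd_kernel_mult iK bdd_kernel_snd bdd_fun_indicator B)
  also have "\<dots> = (\<integral>y. u y * indicator B y \<partial>M)" by (simp add: u_def)
  finally have eq: "(\<integral>x. indicator A x * (\<integral>y. K x y * indicator B y \<partial>M) \<partial>M)
      = (\<integral>y. u y * indicator B y \<partial>M)" .
  have "(\<integral>y. u y * indicator B y \<partial>M)\<^sup>2 \<le> 0"
    using bdd_fun_Cauchy_Schwarz[OF u bdd_fun_indicator[OF B]] u0 by simp
  then show "(\<integral>x. indicator A x * (\<integral>y. K x y * indicator B y \<partial>M) \<partial>M) = 0"
    unfolding eq by simp
qed

text \<open>By Cauchy-Schwarz in each variable, the squared Hilbert-Schmidt norm bounds the square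
  of every matrix coefficient between indicators.\<close>

lemma rect_null_of_square_integral:
  assumes K: "bdd_kernel M K" and null: "(\<integral>x. \<integral>y. (K x y)\<^sup>2 \<partial>M \<partial>M) = 0"
  shows "rect_null M K"
  unfolding rect_null_def
proof (intro ballI)
  fix A B assume A: "A \<in> sets M" and B: "B \<in> sets M"
  define v where "v x = (\<integral>y. K x y * indicator B y \<partial>M)" for x
  have v: "bdd_fun M v" unfolding v_def
    by (intro bdd_kernel_integral bdd_kernel_mult K bdd_kernel_snd bdd_fun_indicator B)
  have K2: "bdd_fun M (\<lambda>x. \<integral>y. (K x y)\<^sup>2 \<partial>M)"
    unfolding power2_eq_square by (intro bdd_kernel_integral bdd_kernel_mult K)
  have ind: "(\<integral>x. (indicator S x)\<^sup>2 \<partial>M) \<le> (1::real)" if "S \<in> sets M" for S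
  proof -
    have "(\<integral>x. (indicator S x)\<^sup>2 \<partial>M) = (\<integral>x. indicator S x \<partial>M :: real)"
      by (intro Bochner_Integration.integral_cong) (auto simp: indicator_def)
    then show ?thesis using that by (simp add: measure_le_1 sets.Int_space_eq2)
  qed
  have v_le: "(v x)\<^sup>2 \<le> (\<integral>y. (K x y)\<^sup>2 \<partial>M)" if "x \<in> space M" for x
  proof -
    have "(v x)\<^sup>2 \<le> (\<integral>y. (K x y)\<^sup>2 \<partial>M) * (\<integral>y. (indicator B y)\<^sup>2 \<partial>M)"
      unfolding v_def by (intro bdd_fun_Cauchy_Schwarz bdd_kernel_section[OF K that] bdd_fun_indicator B)
    also have "\<dots> \<le> (\<integral>y. (K x y)\<^sup>2 \<partial>M) * 1"
      by (intro mult_left_mono ind B) simp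
    finally show ?thesis by simp
  qed
  have "(\<integral>x. (v x)\<^sup>2 \<partial>M) \<le> (\<integral>x. \<integral>y. (K x y)\<^sup>2 \<partial>M \<partial>M)"
    by (intro integral_mono bdd_fun_integrable bdd_fun_power2 v K2 v_le)
  moreover have "0 \<le> (\<integral>x. (v x)\<^sup>2 \<partial>M)" by simp
  ultimately have v0: "(\<integral>x. (v x)\<^sup>2 \<partial>M) = 0" using null by linarith
  have "(\<integral>x. indicator A x * v x \<partial>M)\<^sup>2 \<le> 0"
    using bdd_fun_Cauchy_Schwarz[OF bdd_fun_indicator[OF A] v] v0 by simp
  then show "(\<integral>x. indicator A x * (\<integral>y. K x y * indicator B y \<partial>M) \<partial>M) = 0"
    unfolding v_def by simp
qed

end

section \<open>Power iteration for symmetric kernels\<close>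

locale symmetric_kernel = prob_space M for M :: "'a measure" +
  fixes h :: "'a \<Rightarrow> 'a \<Rightarrow> real"
  assumes kernel: "bdd_kernel M h"
    and sym: "\<lbrakk>x \<in> space M; y \<in> space M\<rbrakk> \<Longrightarrow> h x y = h y x"
begin

text \<open>Shifted by one: \<open>kpow n\<close> is the kernel of the \<open>(n + 1)\<close>-st power of the operator.\<close>
primrec kpow :: "nat \<Rightarrow> 'a \<Rightarrow> 'a \<Rightarrow> real" where
  "kpow 0 = h"
| "kpow (Suc n) = kernel_comp M h (kpow n)"

lemma kpow_kernel: "bdd_kernel M (kpow n)"
  by (induction n) (auto intro: bdd_kernel_comp kernel)

lemma kpow_Suc_add:
  assumes "x \<in> space M" "y \<in> space M"
  shows "kpow (Suc (m + n)) x y = kernel_comp M (kpow m) (kpow n) x y"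
  using assms
proof (induction m arbitrary: x)
  case (Suc m)
  have "kpow (Suc (Suc m + n)) x y = kernel_comp M h (kernel_comp M (kpow m) (kpow n)) x y"
    unfolding add_Suc kpow.simps(2)[of "Suc (m + n)"] kernel_comp_def[of M h]
    by (intro Bochner_Integration.integral_cong refl) (simp only: Suc)
  also have "\<dots> = kernel_comp M (kpow (Suc m)) (kpow n) x y"
    using Suc.prems by (simp add: kernel_comp_assoc kernel kpow_kernel)
  finally show ?case .
qed simp

lemma kpow_sym: "x \<in> space M \<Longrightarrow> y \<in> space M \<Longrightarrow> kpow n x y = kpow n y x"
proof (induction n arbitrary: x y)
  case 0
  then show ?case by (simp add: sym)
next
  case (Suc n)
  have "kpow (Suc n) x y = (\<integral>z. h x z * kpow n z y \<partial>M)" by (simp add: kernel_comp_def)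
  also have "\<dots> = (\<integral>z. kpow n y z * h z x \<partial>M)"
    using Suc by (intro Bochner_Integration.integral_cong refl) (simp add: sym)
  also have "\<dots> = kpow (Suc (n + 0)) y x"
    unfolding kpow_Suc_add[OF Suc.prems(2,1)] by (simp add: kernel_comp_def)
  finally show ?case by simp
qed

text \<open>The kernel of the power \<open>2 * n + 2\<close> on the diagonal, which is the squared
  L2 norm of the section \<open>kpow n x\<close>. Its integral \<open>sq_norm n\<close> is the trace
  of that power and the squared Hilbert-Schmidt norm of the power \<open>n + 1\<close>.\<close>

definition diag :: "nat \<Rightarrow> 'a \<Rightarrow> real" where "diag n x = kpow (Suc (n + n)) x x"

definition sq_norm :: "nat \<Rightarrow> real" where "sq_norm n = (\<integral>x. diag n x \<partial>M)"

lemma diag_bdd: "bdd_fun M (diag n)"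
  unfolding diag_def by (rule bdd_kernelD[OF kpow_kernel]) auto

lemma diag_eq: "x \<in> space M \<Longrightarrow> diag n x = (\<integral>y. (kpow n x y)\<^sup>2 \<partial>M)"
  unfolding diag_def kpow_Suc_add kernel_comp_def power2_eq_square
  by (intro Bochner_Integration.integral_cong refl) (simp add: kpow_sym)

lemma diag_nonneg: "x \<in> space M \<Longrightarrow> 0 \<le> diag n x"
  by (simp add: diag_eq)

text \<open>By symmetry the value at (x, y) is the inner product of the sections
  \<open>kpow m x\<close> and \<open>kpow n y\<close>, whose squared norms stand on the
  right.\<close>

lemma kpow_sq_le:
  assumes x: "x \<in> space M" and y: "y \<in> space M"
  shows "(kpow (Suc (m + n)) x y)\<^sup>2 \<le> diag m x * diag n y"
proof -
  have "kpow (Suc (m + n)) x y = (\<integral>z. kpow m x z * kpow n y z \<partial>M)"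
    unfolding kpow_Suc_add[OF assms] kernel_comp_def
    by (intro Bochner_Integration.integral_cong refl) (simp add: kpow_sym y)
  then show ?thesis
    using bdd_fun_Cauchy_Schwarz[OF bdd_kernel_section(1)[OF kpow_kernel x, of m] bdd_kernel_section(1)[OF kpow_kernel y, of n]]
    by (simp add: diag_eq x y)
qed

text \<open>The index \<open>Suc (n + Suc (Suc n))\<close> is also
  \<open>Suc (Suc n + Suc n)\<close>, so the value estimated by Cauchy-Schwarz is again a diagonal
  one.\<close>

lemma diag_log_convex: "x \<in> space M \<Longrightarrow> (diag (Suc n) x)\<^sup>2 \<le> diag n x * diag (Suc (Suc n)) x"
  using kpow_sq_le[of x x n "Suc (Suc n)"] by (simp add: diag_def)

text \<open>Integrating the Cauchy-Schwarz bound over y keeps the point x in one factor and turns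
  the other into a trace. Through this coupling the rate of the traces governs each single
  point.\<close>

lemma diag_submult:
  assumes "x \<in> space M"
  shows "diag (Suc (m + n)) x \<le> diag m x * sq_norm n"
proof -
  have "diag (Suc (m + n)) x \<le> (\<integral>y. diag m x * diag n y \<partial>M)"
    unfolding diag_eq[OF assms, of "Suc (m + n)"]
    by (intro integral_mono bdd_fun_integrable bdd_fun_power2 bdd_kernel_section kpow_kernel
        bdd_fun_mult bdd_fun_const diag_bdd kpow_sq_le assms)
  then show ?thesis by (simp add: sq_norm_def)
qed

lemma sq_norm_nonneg: "0 \<le> sq_norm n"
  unfolding sq_norm_def by (intro Bochner_Integration.integral_nonneg diag_nonneg)

lemma sq_norm_submult: "sq_norm (Suc (m + n)) \<le> sq_norm m * sq_norm n"
proof -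
  have "sq_norm (Suc (m + n)) \<le> (\<integral>x. diag m x * sq_norm n \<partial>M)"
    unfolding sq_norm_def[of "Suc (m + n)"]
    by (intro integral_mono bdd_fun_integrable bdd_fun_mult bdd_fun_const diag_bdd diag_submult)
  then show ?thesis by (simp add: sq_norm_def)
qed

text \<open>The pointwise log-convexity survives integration by Cauchy-Schwarz applied to the square
  roots of the diagonals.\<close>

lemma sq_norm_log_convex: "(sq_norm (Suc n))\<^sup>2 \<le> sq_norm n * sq_norm (Suc (Suc n))"
proof -
  have "sq_norm (Suc n) \<le> (\<integral>x. sqrt (diag n x) * sqrt (diag (Suc (Suc n)) x) \<partial>M)"
    unfolding sq_norm_def
  proof (intro integral_mono bdd_fun_integrable bdd_fun_mult bdd_fun_sqrt diag_bdd)
    fix x assume x: "x \<in> space M"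
    show "diag (Suc n) x \<le> sqrt (diag n x) * sqrt (diag (Suc (Suc n)) x)"
      unfolding real_sqrt_mult[symmetric]
      by (rule real_le_rsqrt) (rule diag_log_convex[OF x])
  qed
  then have "(sq_norm (Suc n))\<^sup>2 \<le> (\<integral>x. sqrt (diag n x) * sqrt (diag (Suc (Suc n)) x) \<partial>M)\<^sup>2"
    by (intro power_mono sq_norm_nonneg)
  also have "\<dots> \<le> (\<integral>x. (sqrt (diag n x))\<^sup>2 \<partial>M) * (\<integral>x. (sqrt (diag (Suc (Suc n)) x))\<^sup>2 \<partial>M)"
    by (intro bdd_fun_Cauchy_Schwarz bdd_fun_sqrt diag_bdd)
  also have "\<dots> = sq_norm n * sq_norm (Suc (Suc n))"
    unfolding sq_norm_def
    by (intro arg_cong2[of _ _ _ _ "(*)"] Bochner_Integration.integral_cong refl) (simp_all add: diag_nonneg)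
  finally show ?thesis .
qed

text \<open>If one trace vanishes, so do all later ones, among them one for an exponent that is a
  power of two. Exponents are then halved repeatedly, since a symmetric operator whose square is
  zero is itself zero. The index \<open>2 ^ k - 1\<close> stands for the exponent
  \<open>2 ^ k\<close>.\<close>

lemma sq_norm_pos:
  assumes "\<not> rect_null M h"
  shows "0 < sq_norm n"
proof (rule ccontr)
  assume "\<not> 0 < sq_norm n"
  then have n0: "sq_norm n = 0" using sq_norm_nonneg[of n] by simp
  have up: "sq_norm k = 0" if "n \<le> k" for k
  proof (cases "k = n")
    case False
    then have "n < k" using that by simp
    then obtain j where "k = Suc (n + j)" using less_imp_Suc_add by blast
    then show ?thesis using sq_norm_submult[of n j] n0 sq_norm_nonneg[of k] by simp
  qed (simp add: n0)
  have rn: "rect_null M (kpow (2 ^ k - 1))" if "n \<le> 2 ^ k - 1" for k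
  proof (rule rect_null_of_square_integral[OF kpow_kernel])
    have "sq_norm (2 ^ k - 1) = (\<integral>x. \<integral>y. (kpow (2 ^ k - 1) x y)\<^sup>2 \<partial>M \<partial>M)"
      unfolding sq_norm_def by (intro Bochner_Integration.integral_cong refl) (simp add: diag_eq)
    with up[OF that] show "(\<integral>x. \<integral>y. (kpow (2 ^ k - 1) x y)\<^sup>2 \<partial>M \<partial>M) = 0" by simp
  qed
  have down: "rect_null M (kpow m)" if "rect_null M (kpow (Suc (m + m)))" for m
  proof (rule rect_null_of_comp_transpose[OF kpow_kernel])
    have eq: "(\<integral>z. kpow m x z * kpow m y z \<partial>M) = kpow (Suc (m + m)) x y"
      if "x \<in> space M" "y \<in> space M" for x y
      unfolding kpow_Suc_add[OF that] kernel_comp_def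
      by (intro Bochner_Integration.integral_cong refl) (simp add: kpow_sym that)
    have "(\<integral>x. indicator A x * (\<integral>y. (\<integral>z. kpow m x z * kpow m y z \<partial>M) * indicator B y \<partial>M) \<partial>M)
       = (\<integral>x. indicator A x * (\<integral>y. kpow (Suc (m + m)) x y * indicator B y \<partial>M) \<partial>M)" for A B
      by (intro Bochner_Integration.integral_cong arg_cong2[of _ _ _ _ "(*)"] refl) (simp add: eq)
    with that show "rect_null M (\<lambda>x y. \<integral>z. kpow m x z * kpow m y z \<partial>M)"
      by (simp add: rect_null_def)
  qed
  have "rect_null M (kpow (2 ^ k - 1)) \<Longrightarrow> rect_null M h" for k
  proof (induction k)
    case (Suc k)
    have "(2::nat) ^ Suc k - 1 = Suc ((2 ^ k - 1) + (2 ^ k - 1))"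
      using one_le_power[of "2::nat" k] by (cases "(2::nat) ^ k") auto
    with Suc.prems have "rect_null M (kpow (2 ^ k - 1))" using down[of "2 ^ k - 1"] by simp
    then show ?case by (rule Suc.IH)
  qed simp
  moreover have "n \<le> 2 ^ n - 1" using less_exp[of n] by linarith
  ultimately show False using rn assms by blast
qed

text \<open>One \<open>l\<close> serves both purposes: it bounds the growth of the diagonal at each
  point, which yields convergence, and it bounds the traces from below, which keeps the limit away
  from zero.\<close>

lemma spectral_rate:
  assumes "\<not> rect_null M h"
  obtains l where "0 < l" "\<And>n. l ^ Suc n \<le> sq_norm n"
    "\<And>n x. x \<in> space M \<Longrightarrow> diag (Suc n) x \<le> l * diag n x"
proof -
  obtain l where l: "0 < l" "\<And>n. sq_norm (Suc n) \<le> l * sq_norm n" "\<And>n. l ^ Suc n \<le> sq_norm n"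
    by (rule submultiplicative_log_convex_rate[of sq_norm,
        OF sq_norm_pos[OF assms] sq_norm_submult sq_norm_log_convex]) blast
  have "diag (Suc n) x \<le> l * diag n x" if "x \<in> space M" for n x
    by (rule log_convex_le_of_rate[where a = sq_norm])
      (use that l diag_nonneg diag_log_convex diag_submult in auto)
  with l that show ?thesis by blast
qed

end

section \<open>Invariant kernels and eigenfunctions\<close>

locale measure_preserving = prob_space M for M :: "'a measure" +
  fixes T :: "'a \<Rightarrow> 'a"
  assumes T_measurable [measurable]: "T \<in> M \<rightarrow>\<^sub>M M"
    and T_distr: "distr M M T = M"
begin

lemma integral_T:
  fixes f :: "'a \<Rightarrow> 'b::{banach, second_countable_topology}"
  assumes "f \<in> borel_measurable M"
  shows "(\<integral>x. f (T x) \<partial>M) = (\<integral>x. f x \<partial>M)"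
  using integral_distr[OF T_measurable assms] by (simp add: T_distr)

lemma T_space: "x \<in> space M \<Longrightarrow> T x \<in> space M"
  using measurable_space[OF T_measurable] .

end

text \<open>By \<open>mean_zero\<close> the operator annihilates constants, so nonzero functions in
  its range have mean zero and cannot be constant. Invariance is required at every pair of points,
  and this exactness is inherited by all powers.\<close>

locale invariant_kernel = symmetric_kernel M h + measure_preserving M T
  for M :: "'a measure" and h and T +
  assumes invariant: "\<lbrakk>x \<in> space M; y \<in> space M\<rbrakk> \<Longrightarrow> h (T x) (T y) = h x y"
    and mean_zero: "x \<in> space M \<Longrightarrow> (\<integral>y. h x y \<partial>M) = 0"
    and nonzero: "\<not> rect_null M h"
begin

text \<open>T preserves the measure, so the intermediate point z of the composition may be replaced
  by T z.\<close>

lemma kpow_invariant: "x \<in> space M \<Longrightarrow> y \<in> space M \<Longrightarrow> kpow n (T x) (T y) = kpow n x y"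
proof (induction n arbitrary: x y)
  case 0
  then show ?case by (simp add: invariant)
next
  case (Suc n)
  note [measurable] = bdd_fun_measurable[OF bdd_kernel_section(1)[OF kernel T_space[OF Suc.prems(1)]]]
    bdd_fun_measurable[OF bdd_kernel_section(2)[OF kpow_kernel T_space[OF Suc.prems(2)], of n]]
  have "kpow (Suc n) (T x) (T y) = (\<integral>z. h (T x) z * kpow n z (T y) \<partial>M)"
    by (simp add: kernel_comp_def)
  also have "\<dots> = (\<integral>z. h (T x) (T z) * kpow n (T z) (T y) \<partial>M)"
    by (rule integral_T[symmetric]) measurable
  also have "\<dots> = kpow (Suc n) x y"
    unfolding kpow.simps kernel_comp_def using Suc
    by (intro Bochner_Integration.integral_cong refl) (simp add: invariant)
  finally show ?case .
qed

lemma kpow_mean_zero: "x \<in> space M \<Longrightarrow> (\<integral>y. kpow n x y \<partial>M) = 0"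
proof (induction n arbitrary: x)
  case 0
  then show ?case by (simp add: mean_zero)
next
  case (Suc n)
  have "(\<integral>y. kpow (Suc n) x y \<partial>M) = (\<integral>y. \<integral>z. h x z * kpow n z y \<partial>M \<partial>M)"
    by (simp add: kernel_comp_def)
  also have "\<dots> = (\<integral>z. \<integral>y. h x z * kpow n z y \<partial>M \<partial>M)"
    by (rule bdd_kernel_Fubini[symmetric])
      (intro bdd_kernel_mult kpow_kernel bdd_kernel_fst bdd_kernel_section kernel Suc.prems)
  also have "\<dots> = (\<integral>z. 0 \<partial>M)"
    by (intro Bochner_Integration.integral_cong refl) (simp add: Suc.IH)
  finally show ?case by simp
qed

text \<open>The normalised powers of the kernel converge pointwise to the kernel of the orthogonal
  projection onto the eigenspace of the largest eigenvalue of its square.\<close>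
lemma projection_kernel_exists:
  obtains p where "bdd_kernel M p"
    "\<And>x y. \<lbrakk>x \<in> space M; y \<in> space M\<rbrakk> \<Longrightarrow> p x y = p y x"
    "\<And>x y. \<lbrakk>x \<in> space M; y \<in> space M\<rbrakk> \<Longrightarrow> p (T x) (T y) = p x y"
    "\<And>x y. \<lbrakk>x \<in> space M; y \<in> space M\<rbrakk> \<Longrightarrow> (\<integral>z. p x z * p z y \<partial>M) = p x y"
    "\<And>x. x \<in> space M \<Longrightarrow> (\<integral>y. p x y \<partial>M) = 0"
    "1 \<le> (\<integral>x. p x x \<partial>M)"
proof -
  obtain l where l: "0 < l" "\<And>n. l ^ Suc n \<le> sq_norm n"
    "\<And>n x. x \<in> space M \<Longrightarrow> diag (Suc n) x \<le> l * diag n x"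
    by (rule spectral_rate[OF nonzero]) blast
  \<comment> \<open>The kernel of the power \<open>n + 1\<close> of the squared operator divided by
    \<open>l\<close>.\<close>
  define P where "P n x y = kpow (Suc (n + n)) x y / l ^ Suc n" for n x y
  have P_kernel: "bdd_kernel M (P n)" for n
    using bdd_fun_divide[of "M \<Otimes>\<^sub>M M" "\<lambda>(x, y). kpow (Suc (n + n)) x y" "l ^ Suc n"] kpow_kernel[of "Suc (n + n)"]
    unfolding bdd_kernel_def P_def case_prod_unfold by blast
  have P_sym: "P n x y = P n y x" if "x \<in> space M" "y \<in> space M" for n x y
    using kpow_sym that unfolding P_def by metis
  have P_comp: "(\<integral>z. P m x z * P n z y \<partial>M) = P (Suc (m + n)) x y"
    if "x \<in> space M" "y \<in> space M" for m n x y
  proof -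
    have "(\<integral>z. P m x z * P n z y \<partial>M)
        = (\<integral>z. kpow (Suc (m + m)) x z * kpow (Suc (n + n)) z y \<partial>M) / (l ^ Suc m * l ^ Suc n)"
      unfolding P_def by (simp flip: integral_divide_zero)
    also have "(\<integral>z. kpow (Suc (m + m)) x z * kpow (Suc (n + n)) z y \<partial>M)
        = kpow (Suc (Suc (m + m) + Suc (n + n))) x y"
      by (simp only: kpow_Suc_add[OF that] kernel_comp_def)
    also have "Suc (m + m) + Suc (n + n) = Suc (m + n) + Suc (m + n)" by simp
    also have "l ^ Suc m * l ^ Suc n = l ^ Suc (Suc (m + n))" by (simp add: power_add)
    finally show ?thesis unfolding P_def .
  qed
  have P_diag: "P n x x = diag n x / l ^ Suc n" for n x by (simp only: P_def diag_def)
  have P_diag_nonneg: "0 \<le> P n x x" if "x \<in> space M" for n x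
    using diag_nonneg[OF that] l(1) by (simp add: P_diag)
  \<comment> \<open>By the choice of \<open>l\<close> the normalised diagonal decreases at every
    point; it therefore converges there and is dominated by its value for
    \<open>n = 0\<close>.\<close>
  have P_diag_decseq: "decseq (\<lambda>n. P n x x)" if "x \<in> space M" for x
    using l(1) l(3)[OF that] by (intro decseq_SucI) (simp add: P_diag field_simps)
  obtain D where D: "0 \<le> D" "\<forall>x\<in>space M. \<bar>P 0 x x\<bar> \<le> D"
    using bdd_fun_bound[OF bdd_kernelD[OF P_kernel[of 0], of "\<lambda>x. x" M "\<lambda>x. x"]] by auto
  have P_diag_le: "P n x x \<le> D" if "x \<in> space M" for n x
    using decseqD[OF P_diag_decseq[OF that], of 0 n] D(2) that by force
  have P_bound: "\<bar>P n x y\<bar> \<le> D" if "x \<in> space M" "y \<in> space M" for n x y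
  proof -
    have "(P n x y)\<^sup>2 \<le> P n x x * P n y y"
      using kpow_sq_le[OF that, of n n] l(1)
      unfolding P_diag unfolding P_def by (simp add: power_divide divide_right_mono power2_eq_square)
    also have "\<dots> \<le> D * D"
      using P_diag_le P_diag_nonneg D(1) that by (intro mult_mono) auto
    finally have "\<bar>P n x y\<bar>\<^sup>2 \<le> D\<^sup>2" by (simp add: power2_eq_square)
    then show ?thesis using D(1) by (rule power2_le_imp_le)
  qed
  have P_Cauchy: "Cauchy (\<lambda>n. P (Suc n) x y)" if x: "x \<in> space M" and y: "y \<in> space M" for x y
  proof (rule metric_CauchyI)
    fix e :: real assume e: "0 < e"
    \<comment> \<open>The squared difference will be at most \<open>2 * c * P 1 y y\<close>; the
      added 1 makes the final bound strict and the denominator positive.\<close>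
    define c where "c = e\<^sup>2 / (2 * (P 1 y y + 1))"
    have c: "0 < c" using e P_diag_nonneg[OF y, of 1] by (simp add: c_def)
    have "convergent (\<lambda>n. P n x x)"
      using P_diag_decseq[OF x] P_diag_nonneg[OF x] by (blast intro: decseq_convergent convergentI)
    then obtain N where N: "\<And>m n. N \<le> m \<Longrightarrow> N \<le> n \<Longrightarrow> \<bar>P m x x - P n x x\<bar> < c"
      using c by (metis Cauchy_convergent_iff metric_CauchyD dist_real_def)
    have "\<bar>P (Suc i) x y - P (Suc j) x y\<bar> < e" if ij: "N \<le> i" "N \<le> j" for i j
    proof -
      have sec: "bdd_fun M (P n x)" "bdd_fun M (\<lambda>z. P n z y)" for n
        using bdd_kernel_section[OF P_kernel] x y by auto
      have int: "integrable M (\<lambda>z. P m x z * P n z y)" "integrable M (\<lambda>z. P m x z * P n x z)" for m n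
        by (intro bdd_fun_integrable bdd_fun_mult sec)+
      have inner: "(\<integral>z. P m x z * P n x z \<partial>M) = P (Suc (m + n)) x x" for m n
        using P_comp[OF x x, of m n] P_sym[OF x] by (metis (mono_tags, lifting) Bochner_Integration.integral_cong)
      \<comment> \<open>One factor \<open>P 0\<close> is split off, so that the difference is an
        inner product with a section not depending on i and j. The squared norm of the other factor
        expands into three diagonal values at x, whose convergence is known.\<close>
      have "P (Suc i) x y - P (Suc j) x y = (\<integral>z. (P i x z - P j x z) * P 0 z y \<partial>M)"
        using P_comp[OF x y, of i 0] P_comp[OF x y, of j 0] int by (simp add: left_diff_distrib)
      then have "(P (Suc i) x y - P (Suc j) x y)\<^sup>2
          \<le> (\<integral>z. (P i x z - P j x z)\<^sup>2 \<partial>M) * (\<integral>z. (P 0 z y)\<^sup>2 \<partial>M)"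
        by (simp add: bdd_fun_Cauchy_Schwarz bdd_fun_diff sec)
      also have "(\<integral>z. (P i x z - P j x z)\<^sup>2 \<partial>M)
          = (\<integral>z. P i x z * P i x z - 2 * (P i x z * P j x z) + P j x z * P j x z \<partial>M)"
        by (intro Bochner_Integration.integral_cong) (auto simp: power2_eq_square algebra_simps)
      also have "\<dots> = P (Suc (i + i)) x x - 2 * P (Suc (i + j)) x x + P (Suc (j + j)) x x"
        using int by (simp add: inner)
      also have "(\<integral>z. (P 0 z y)\<^sup>2 \<partial>M) = (\<integral>z. P 0 y z * P 0 z y \<partial>M)"
        by (intro Bochner_Integration.integral_cong) (auto simp: power2_eq_square P_sym[OF y])
      also have "\<dots> = P 1 y y" using P_comp[OF y y, of 0 0] by simp
      also have "(P (Suc (i + i)) x x - 2 * P (Suc (i + j)) x x + P (Suc (j + j)) x x) * P 1 y y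
          \<le> (2 * c) * P 1 y y"
        using N[of "Suc (i + i)" "Suc (i + j)"] N[of "Suc (j + j)" "Suc (i + j)"] ij P_diag_nonneg[OF y, of 1]
        by (intro mult_right_mono) auto
      also have "\<dots> < (2 * c) * (P 1 y y + 1)" using c by simp
      also have "\<dots> = e\<^sup>2" using P_diag_nonneg[OF y, of 1] by (simp add: c_def field_simps)
      finally have "\<bar>P (Suc i) x y - P (Suc j) x y\<bar>\<^sup>2 < e\<^sup>2" by simp
      from power2_less_imp_less[OF this] e show ?thesis by simp
    qed
    then show "\<exists>N. \<forall>m\<ge>N. \<forall>n\<ge>N. dist (P (Suc m) x y) (P (Suc n) x y) < e"
      by (auto simp: dist_real_def)
  qed
  define p where "p x y = lim (\<lambda>n. P n x y)" for x y
  have p_lim: "(\<lambda>n. P n x y) \<longlonglongrightarrow> p x y" if "x \<in> space M" "y \<in> space M" for x y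
  proof -
    have "convergent (\<lambda>n. P n x y)"
      using P_Cauchy[OF that] convergent_Suc_iff[of "\<lambda>n. P n x y"] by (simp add: Cauchy_convergent_iff)
    then show ?thesis by (simp add: p_def convergent_LIMSEQ_iff)
  qed
  have p_bound: "\<bar>p x y\<bar> \<le> D" if "x \<in> space M" "y \<in> space M" for x y
    using tendsto_rabs[OF p_lim[OF that]] P_bound[OF that] by (intro LIMSEQ_le_const2) auto
  have p_kernel: "bdd_kernel M p"
    unfolding bdd_kernel_def
  proof (rule bdd_funI[of _ _ D])
    have [measurable]: "(\<lambda>(x, y). P n x y) \<in> borel_measurable (M \<Otimes>\<^sub>M M)" for n
      using bdd_fun_measurable[OF P_kernel[unfolded bdd_kernel_def]] .
    show "(\<lambda>(x, y). p x y) \<in> borel_measurable (M \<Otimes>\<^sub>M M)"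
      unfolding p_def by measurable
  qed (auto simp: space_pair_measure p_bound)
  \<comment> \<open>Dominated convergence with both factors varying. Taking \<open>P n z y\<close>
    for the second factor gives idempotence, taking 1 gives mean zero.\<close>
  have p_lim_integral: "(\<lambda>n. \<integral>z. P n x z * f n z \<partial>M) \<longlonglongrightarrow> (\<integral>z. p x z * g z \<partial>M)"
    if x: "x \<in> space M" and f: "\<And>n. f n \<in> borel_measurable M" and g: "g \<in> borel_measurable M"
      and lim: "\<And>z. z \<in> space M \<Longrightarrow> (\<lambda>n. f n z) \<longlonglongrightarrow> g z"
      and bound: "\<And>n z. z \<in> space M \<Longrightarrow> \<bar>f n z\<bar> \<le> B" for x f g B
  proof (rule integral_dominated_convergence[where w = "\<lambda>_. D * B"])
    note [measurable] = f g bdd_fun_measurable[OF bdd_kernel_section(1)[OF P_kernel x]]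
      bdd_fun_measurable[OF bdd_kernel_section(1)[OF p_kernel x]]
    show "(\<lambda>z. p x z * g z) \<in> borel_measurable M" by measurable
    show "(\<lambda>z. P n x z * f n z) \<in> borel_measurable M" for n by measurable
    show "AE z in M. (\<lambda>n. P n x z * f n z) \<longlonglongrightarrow> p x z * g z"
      by (intro AE_I2 tendsto_mult p_lim lim x)
    show "AE z in M. norm (P n x z * f n z) \<le> D * B" for n
      using x P_bound bound D(1) by (intro AE_I2) (auto simp: abs_mult intro!: mult_mono)
  qed simp
  show ?thesis
  proof (rule that[of p])
    show "p x y = p y x" if "x \<in> space M" "y \<in> space M" for x y
      unfolding p_def by (subst P_sym[OF that]) (rule refl)
    show "p (T x) (T y) = p x y" if "x \<in> space M" "y \<in> space M" for x y
      using that unfolding p_def P_def by (simp only: kpow_invariant)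
    show "(\<integral>z. p x z * p z y \<partial>M) = p x y" if xy: "x \<in> space M" "y \<in> space M" for x y
    proof (rule LIMSEQ_unique)
      show "(\<lambda>n. \<integral>z. P n x z * P n z y \<partial>M) \<longlonglongrightarrow> (\<integral>z. p x z * p z y \<partial>M)"
        by (rule p_lim_integral[OF xy(1), of "\<lambda>n z. P n z y" "\<lambda>z. p z y" D])
          (use xy p_lim P_bound bdd_kernel_section[OF P_kernel] bdd_kernel_section[OF p_kernel] in \<open>auto intro: bdd_fun_measurable\<close>)
      \<comment> \<open>Composing \<open>P n\<close> with itself gives the member of index
        \<open>Suc (n + n)\<close> of the same sequence, so the limit equals its own square.\<close>
      show "(\<lambda>n. \<integral>z. P n x z * P n z y \<partial>M) \<longlonglongrightarrow> p x y"
        unfolding P_comp[OF xy]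
        using LIMSEQ_subseq_LIMSEQ[OF p_lim[OF xy], of "\<lambda>n. Suc (n + n)"]
        by (simp add: strict_mono_def o_def)
    qed
    show "(\<integral>y. p x y \<partial>M) = 0" if x: "x \<in> space M" for x
    proof (rule LIMSEQ_unique)
      show "(\<lambda>n. \<integral>y. P n x y \<partial>M) \<longlonglongrightarrow> (\<integral>y. p x y \<partial>M)"
        using p_lim_integral[OF x, of "\<lambda>_ _. 1" "\<lambda>_. 1" 1] by simp
      show "(\<lambda>n. \<integral>y. P n x y \<partial>M) \<longlonglongrightarrow> 0"
        unfolding P_def using kpow_mean_zero[OF x] by (simp del: kpow.simps)
    qed
    show "1 \<le> (\<integral>x. p x x \<partial>M)"
    proof (rule LIMSEQ_le_const)
      show "(\<lambda>n. \<integral>x. P n x x \<partial>M) \<longlonglongrightarrow> (\<integral>x. p x x \<partial>M)"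
      proof (rule integral_dominated_convergence[where w = "\<lambda>_. D"])
        show "(\<lambda>x. p x x) \<in> borel_measurable M" "(\<lambda>x. P n x x) \<in> borel_measurable M" for n
          by (intro bdd_fun_measurable bdd_kernelD[of M] p_kernel P_kernel measurable_ident_sets refl)+
      qed (use p_lim P_bound in auto)
      have "1 \<le> (\<integral>x. P n x x \<partial>M)" for n
        using l(1) l(2)[of n] by (simp add: P_diag sq_norm_def del: power_Suc)
      then show "\<exists>N. \<forall>n\<ge>N. 1 \<le> (\<integral>x. P n x x \<partial>M)" by blast
    qed
  qed (rule p_kernel)
qed

end

section \<open>The range of the projection and its eigenfunctions\<close>

context invariant_kernel
begin

text \<open>The kernel \<open>p\<close> reproduces the functions in its range \<open>R\<close>: f x
  is the inner product of f with \<open>p x\<close>. The norm of f thus controls each of its values,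
  so expansion in an orthonormal system holds at every point.\<close>

lemma eigenfunction_exists:
  obtains w :: "'a \<Rightarrow> complex" and r where "w \<in> borel_measurable M"
    "\<And>x. x \<in> space M \<Longrightarrow> w (T x) = r * w x" "\<And>k. \<not> (AE x in M. w x = k)"
proof -
  obtain p where p: "bdd_kernel M p"
    and p_sym: "\<And>x y. \<lbrakk>x \<in> space M; y \<in> space M\<rbrakk> \<Longrightarrow> p x y = p y x"
    and p_inv: "\<And>x y. \<lbrakk>x \<in> space M; y \<in> space M\<rbrakk> \<Longrightarrow> p (T x) (T y) = p x y"
    and p_idem: "\<And>x y. \<lbrakk>x \<in> space M; y \<in> space M\<rbrakk> \<Longrightarrow> (\<integral>z. p x z * p z y \<partial>M) = p x y"
    and p_mean: "\<And>x. x \<in> space M \<Longrightarrow> (\<integral>y. p x y \<partial>M) = 0"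
    and p_trace: "1 \<le> (\<integral>x. p x x \<partial>M)"
    by (rule projection_kernel_exists) blast
  note p_sec = bdd_kernel_section(1)[OF p]
  define R where "R = {f. bdd_fun M f \<and> (\<forall>x\<in>space M. f x = (\<integral>y. p x y * f y \<partial>M))}"
  define ip where "ip f g = (\<integral>x. f x * g x \<partial>M)" for f g :: "'a \<Rightarrow> real"
  define ons where "ons N e \<longleftrightarrow> (\<forall>i<N. e i \<in> R) \<and>
    (\<forall>i<N. \<forall>j<N. ip (e i) (e j) = (if i = j then 1 else 0))" for N :: nat and e
  have R_bdd: "bdd_fun M f" if "f \<in> R" for f using that by (simp add: R_def)
  have R_int: "integrable M (\<lambda>x. f x * g x)" if "f \<in> R" "g \<in> R" for f g
    using that by (intro bdd_fun_integrable bdd_fun_mult R_bdd)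
  have R_repr: "f x = (\<integral>y. p x y * f y \<partial>M)" if "f \<in> R" "x \<in> space M" for f x
    using that by (simp add: R_def)
  have p_int: "integrable M (\<lambda>y. p x y * f y)" if "f \<in> R" "x \<in> space M" for f x
    using that by (intro bdd_fun_integrable bdd_fun_mult R_bdd p_sec)
  have R_cmult: "(\<lambda>x. c * f x) \<in> R" if "f \<in> R" for c f
    unfolding R_def
  proof (intro CollectI conjI ballI)
    show "bdd_fun M (\<lambda>x. c * f x)" by (intro bdd_fun_mult bdd_fun_const R_bdd that)
    show "c * f x = (\<integral>y. p x y * (c * f y) \<partial>M)" if x: "x \<in> space M" for x
      using R_repr[OF \<open>f \<in> R\<close> x] by (simp add: mult.left_commute)
  qed
  have R_diff: "(\<lambda>x. f x - g x) \<in> R" if "f \<in> R" "g \<in> R" for f g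
    unfolding R_def
  proof (intro CollectI conjI ballI)
    show "bdd_fun M (\<lambda>x. f x - g x)" by (intro bdd_fun_diff R_bdd that)
    show "f x - g x = (\<integral>y. p x y * (f y - g y) \<partial>M)" if x: "x \<in> space M" for x
      using p_int[OF \<open>f \<in> R\<close> x] p_int[OF \<open>g \<in> R\<close> x] R_repr[OF \<open>f \<in> R\<close> x] R_repr[OF \<open>g \<in> R\<close> x]
      by (simp add: right_diff_distrib)
  qed
  have R_sum: "(\<lambda>x. \<Sum>i<N. c i * e i x) \<in> R" if eR: "\<And>i. i < N \<Longrightarrow> e i \<in> R" for N :: nat and c e
    unfolding R_def
  proof (intro CollectI conjI ballI)
    show "bdd_fun M (\<lambda>x. \<Sum>i<N. c i * e i x)"
      by (intro bdd_fun_sum bdd_fun_mult bdd_fun_const R_bdd eR) simp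
    show "(\<Sum>i<N. c i * e i x) = (\<integral>y. p x y * (\<Sum>i<N. c i * e i y) \<partial>M)" if x: "x \<in> space M" for x
    proof -
      have "(\<integral>y. p x y * (\<Sum>i<N. c i * e i y) \<partial>M) = (\<integral>y. (\<Sum>i<N. c i * (p x y * e i y)) \<partial>M)"
        by (simp add: sum_distrib_left mult.left_commute)
      also have "\<dots> = (\<Sum>i<N. \<integral>y. c i * (p x y * e i y) \<partial>M)"
        by (intro Bochner_Integration.integral_sum integrable_mult_right p_int x eR) simp
      also have "\<dots> = (\<Sum>i<N. c i * e i x)"
        using R_repr[OF eR x] by (intro sum.cong) auto
      finally show ?thesis by simp
    qed
  qed
  \<comment> \<open>Since \<open>p\<close> is invariant and T preserves the measure, the projection
    commutes with composition with T.\<close>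
  have R_T: "(\<lambda>x. f (T x)) \<in> R" if f: "f \<in> R" for f
    unfolding R_def
  proof (intro CollectI conjI ballI)
    show "bdd_fun M (\<lambda>x. f (T x))" by (rule bdd_fun_compose[OF R_bdd[OF f] T_measurable])
    show "f (T x) = (\<integral>y. p x y * f (T y) \<partial>M)" if x: "x \<in> space M" for x
    proof -
      have "f (T x) = (\<integral>y. p (T x) y * f y \<partial>M)" by (rule R_repr[OF f T_space[OF x]])
      also have "\<dots> = (\<integral>y. p (T x) (T y) * f (T y) \<partial>M)"
        by (rule integral_T[symmetric])
          (intro bdd_fun_measurable bdd_fun_mult p_sec R_bdd f T_space x)
      also have "\<dots> = (\<integral>y. p x y * f (T y) \<partial>M)"
        by (intro Bochner_Integration.integral_cong refl) (simp add: p_inv x)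
      finally show ?thesis .
    qed
  qed
  have p_sq: "(\<integral>y. (p x y)\<^sup>2 \<partial>M) = p x x" if "x \<in> space M" for x
  proof -
    have "(\<integral>y. (p x y)\<^sup>2 \<partial>M) = (\<integral>y. p x y * p y x \<partial>M)"
      by (intro Bochner_Integration.integral_cong) (auto simp: power2_eq_square p_sym[OF that])
    then show ?thesis by (simp add: p_idem that)
  qed
  have p_diag: "bdd_fun M (\<lambda>x. p x x)" by (rule bdd_kernelD[OF p]) auto

  have ip_sum_left: "ip (\<lambda>x. \<Sum>i<N. c i * e i x) g = (\<Sum>i<N. c i * ip (e i) g)"
    if "\<And>i. i < N \<Longrightarrow> e i \<in> R" "g \<in> R" for N :: nat and c e g
  proof -
    have "ip (\<lambda>x. \<Sum>i<N. c i * e i x) g = (\<integral>x. (\<Sum>i<N. c i * (e i x * g x)) \<partial>M)"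
      by (simp add: ip_def sum_distrib_right mult.assoc)
    also have "\<dots> = (\<Sum>i<N. \<integral>x. c i * (e i x * g x) \<partial>M)"
      by (intro Bochner_Integration.integral_sum integrable_mult_right R_int that) auto
    finally show ?thesis by (simp add: ip_def)
  qed

  \<comment> \<open>Here \<open>u\<close> is the orthogonal projection of the section
    \<open>p x\<close> onto the span of the system. The reproducing property turns its squared norm
    into \<open>u x\<close>, and it is no longer than \<open>p x\<close>, whose squared norm is
    \<open>p x x\<close>.\<close>
  have Bessel: "(\<Sum>i<N. (e i x)\<^sup>2) \<le> p x x" if e: "ons N e" and x: "x \<in> space M" for N e x
  proof -
    have eR: "\<And>i. i < N \<Longrightarrow> e i \<in> R" using e by (simp add: ons_def)
    define u where "u = (\<lambda>y. \<Sum>i<N. e i x * e i y)"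
    have u: "u \<in> R" unfolding u_def by (rule R_sum[OF eR])
    have ux: "u x = (\<Sum>i<N. (e i x)\<^sup>2)" by (simp add: u_def power2_eq_square)
    have "ip u u = (\<Sum>i<N. e i x * ip (e i) u)"
      by (subst (1) u_def) (rule ip_sum_left[OF eR u])
    also have "\<dots> = (\<Sum>i<N. e i x * e i x)"
    proof (intro sum.cong refl arg_cong2[of _ _ _ _ "(*)"])
      fix i assume i: "i \<in> {..<N}"
      have "ip (e i) u = ip u (e i)" by (simp add: ip_def mult.commute)
      also have "\<dots> = (\<Sum>j<N. e j x * ip (e j) (e i))"
        unfolding u_def by (rule ip_sum_left[OF eR]) (use i eR in auto)
      also have "\<dots> = (\<Sum>j<N. if j = i then e j x else 0)"
        using e i by (intro sum.cong) (auto simp: ons_def)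
      also have "\<dots> = e i x" using i by simp
      finally show "ip (e i) u = e i x" .
    qed
    finally have uu: "ip u u = u x" by (simp add: ux power2_eq_square)
    have "0 \<le> (\<integral>y. (p x y - u y)\<^sup>2 \<partial>M)" by simp
    also have "\<dots> = (\<integral>y. (p x y)\<^sup>2 - 2 * (p x y * u y) + u y * u y \<partial>M)"
      by (intro Bochner_Integration.integral_cong) (auto simp: power2_eq_square algebra_simps)
    also have "\<dots> = p x x - 2 * u x + u x"
      using bdd_fun_integrable[OF bdd_fun_power2[OF p_sec[OF x]]] p_int[OF u x] R_int[OF u u]
        p_sq[OF x] R_repr[OF u x] uu by (simp add: ip_def)
    finally show ?thesis by (simp add: ux)
  qed
  have ons_le: "real N \<le> (\<integral>x. p x x \<partial>M)" if e: "ons N e" for N e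
  proof -
    have sq: "bdd_fun M (\<lambda>x. (e i x)\<^sup>2)" if "i < N" for i
      using e that by (intro bdd_fun_power2 R_bdd) (simp add: ons_def)
    have "real N = (\<Sum>i<N. \<integral>x. (e i x)\<^sup>2 \<partial>M)"
      using e by (simp add: ons_def ip_def power2_eq_square)
    also have "\<dots> = (\<integral>x. (\<Sum>i<N. (e i x)\<^sup>2) \<partial>M)"
      by (intro Bochner_Integration.integral_sum[symmetric] bdd_fun_integrable sq) simp
    also have "\<dots> \<le> (\<integral>x. p x x \<partial>M)"
      by (intro integral_mono bdd_fun_integrable bdd_fun_sum p_diag sq Bessel[OF e]) auto
    finally show ?thesis .
  qed

  \<comment> \<open>A positive trace yields a point a with \<open>p a a\<close> positive; the
    section there lies in \<open>R\<close> and has norm \<open>sqrt (p a a)\<close>. This ensures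
    that the matrix below has positive size.\<close>
  have ons1: "\<exists>e. ons 1 e"
  proof -
    have "\<exists>x\<in>space M. 0 < p x x"
    proof (rule ccontr)
      assume "\<not> ?thesis"
      then have "(\<integral>x. p x x \<partial>M) \<le> (\<integral>x. 0 \<partial>M)"
        by (intro integral_mono bdd_fun_integrable p_diag bdd_fun_const) auto
      with p_trace show False by simp
    qed
    then obtain a where a: "a \<in> space M" "0 < p a a" by blast
    have pa: "p a \<in> R"
      unfolding R_def
    proof (intro CollectI conjI ballI)
      show "p a x = (\<integral>y. p x y * p a y \<partial>M)" if x: "x \<in> space M" for x
      proof -
        have "(\<integral>y. p x y * p a y \<partial>M) = (\<integral>y. p x y * p y a \<partial>M)"
          by (intro Bochner_Integration.integral_cong refl) (simp add: p_sym[OF a(1)])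
        then show ?thesis using p_idem[OF x a(1)] p_sym[OF x a(1)] by simp
      qed
    qed (rule p_sec[OF a(1)])
    have "ip (\<lambda>x. 1 / sqrt (p a a) * p a x) (\<lambda>x. 1 / sqrt (p a a) * p a x) = 1"
    proof -
      have "ip (\<lambda>x. 1 / sqrt (p a a) * p a x) (\<lambda>x. 1 / sqrt (p a a) * p a x)
          = (\<integral>x. (p a x)\<^sup>2 / p a a \<partial>M)"
        unfolding ip_def using a(2)
        by (intro Bochner_Integration.integral_cong) (auto simp: power2_eq_square field_simps)
      then show ?thesis using p_sq[OF a(1)] a(2) by simp
    qed
    then show ?thesis
      using R_cmult[OF pa, of "1 / sqrt (p a a)"] by (intro exI[of _ "\<lambda>_ x. 1 / sqrt (p a a) * p a x"]) (simp add: ons_def)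
  qed
  have "\<exists>N. (\<exists>e. ons N e) \<and> (\<forall>n. (\<exists>e. ons n e) \<longrightarrow> n \<le> N)"
  proof (rule Nat.ex_has_greatest_nat)
    show "\<exists>e. ons 1 e" by (rule ons1)
    show "\<forall>n. (\<exists>e. ons n e) \<longrightarrow> n \<le> nat \<lceil>\<integral>x. p x x \<partial>M\<rceil>"
    proof (intro allI impI)
      fix n assume "\<exists>e. ons n e"
      then have "real n \<le> (\<integral>x. p x x \<partial>M)" using ons_le by blast
      also have "\<dots> \<le> real (nat \<lceil>\<integral>x. p x x \<partial>M\<rceil>)" by (rule real_nat_ceiling_ge)
      finally show "n \<le> nat \<lceil>\<integral>x. p x x \<partial>M\<rceil>" by simp
    qed
  qed
  then obtain N e where e: "ons N e" and N_max: "\<And>n f. ons n f \<Longrightarrow> n \<le> N" by blast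
  have N_pos: "0 < N" using ons1 N_max by fastforce
  have eR: "e i \<in> R" if "i < N" for i using e that by (simp add: ons_def)
  have e_on: "ip (e i) (e j) = (if i = j then 1 else 0)" if "i < N" "j < N" for i j
    using e that by (simp add: ons_def)

  \<comment> \<open>The remainder \<open>g\<close> is orthogonal to a system of maximal size, so its
    norm is zero. The reproducing property then makes it vanish at every point, not only almost
    everywhere.\<close>
  have span: "f x = (\<Sum>i<N. ip f (e i) * e i x)" if f: "f \<in> R" and x: "x \<in> space M" for f x
  proof -
    define s where "s y = (\<Sum>i<N. ip f (e i) * e i y)" for y
    define g where "g y = f y - s y" for y
    have s: "s \<in> R" unfolding s_def by (rule R_sum[OF eR])
    have g: "g \<in> R" unfolding g_def by (rule R_diff[OF f s])
    have orth: "ip g (e j) = 0" if j: "j < N" for j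
    proof -
      have "ip s (e j) = (\<Sum>i<N. ip f (e i) * ip (e i) (e j))"
        unfolding s_def by (rule ip_sum_left[OF eR]) (use j eR in auto)
      also have "\<dots> = (\<Sum>i<N. if i = j then ip f (e i) else 0)"
        using j by (intro sum.cong) (auto simp: e_on)
      also have "\<dots> = ip f (e j)" using j by simp
      finally show ?thesis
        using R_int[OF f eR[OF j]] R_int[OF s eR[OF j]] by (simp add: ip_def g_def left_diff_distrib)
    qed
    have gg: "ip g g = 0"
    proof (rule ccontr)
      assume "ip g g \<noteq> 0"
      then have pos: "0 < ip g g" by (simp add: ip_def order_less_le)
      define k where "k = 1 / sqrt (ip g g)"
      define e' where "e' = e(N := (\<lambda>y. k * g y))"
      have "ons (Suc N) e'"
        unfolding ons_def
      proof (intro conjI allI impI)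
        show "e' i \<in> R" if "i < Suc N" for i
          using that eR[of i] R_cmult[OF g] by (auto simp: e'_def less_Suc_eq)
        have "ip (\<lambda>y. k * g y) (\<lambda>y. k * g y) = (\<integral>y. k * k * (g y * g y) \<partial>M)"
          by (simp add: ip_def ac_simps)
        also have "\<dots> = k * k * ip g g" by (simp add: ip_def)
        also have "\<dots> = 1" using pos by (simp add: k_def)
        finally have kk: "ip (\<lambda>y. k * g y) (\<lambda>y. k * g y) = 1" .
        have k0: "ip (\<lambda>y. k * g y) (e j) = 0" "ip (e j) (\<lambda>y. k * g y) = 0" if "j < N" for j
          using orth[OF that] by (simp_all add: ip_def ac_simps)
        show "ip (e' i) (e' j) = (if i = j then 1 else 0)" if "i < Suc N" "j < Suc N" for i j
          using that e_on[of i j] kk k0 by (auto simp: e'_def less_Suc_eq)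
      qed
      then show False using N_max by fastforce
    qed
    have "(g x)\<^sup>2 \<le> (\<integral>y. (p x y)\<^sup>2 \<partial>M) * (\<integral>y. (g y)\<^sup>2 \<partial>M)"
      unfolding R_repr[OF g x] by (rule bdd_fun_Cauchy_Schwarz[OF p_sec[OF x] R_bdd[OF g]])
    then have "g x = 0" using gg by (simp add: ip_def flip: power2_eq_square)
    then show ?thesis by (simp add: g_def s_def)
  qed

  define c where "c i j = ip (\<lambda>x. e i (T x)) (e j)" for i j
  have eT: "e i (T x) = (\<Sum>j<N. c i j * e j x)" if "i < N" "x \<in> space M" for i x
    unfolding c_def by (rule span[OF R_T[OF eR[OF that(1)]] that(2)])
  \<comment> \<open>The matrix is the transpose of \<open>c\<close>, because the coefficients
    \<open>v\<close> are summed against the first index of \<open>c\<close> when the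
    \<open>e i (T x)\<close> are combined.\<close>
  obtain v r where v: "\<exists>i<N. v i \<noteq> 0"
    "\<And>i. i < N \<Longrightarrow> (\<Sum>j<N. complex_of_real (c j i) * v j) = r * v i"
    by (rule complex_matrix_has_eigenvector[OF N_pos, of "\<lambda>i j. complex_of_real (c j i)"]) blast
  define w where "w x = (\<Sum>i<N. v i * complex_of_real (e i x))" for x
  have e_meas: "e i \<in> borel_measurable M" if "i < N" for i
    using bdd_fun_measurable[OF R_bdd[OF eR[OF that]]] .
  have w_meas: "w \<in> borel_measurable M"
    unfolding w_def using e_meas by (intro borel_measurable_sum borel_measurable_times borel_measurable_const) auto
  have w_T: "w (T x) = r * w x" if x: "x \<in> space M" for x
  proof -
    have "w (T x) = (\<Sum>i<N. \<Sum>j<N. v i * (complex_of_real (c i j) * complex_of_real (e j x)))"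
      by (simp add: w_def eT x sum_distrib_left)
    also have "\<dots> = (\<Sum>j<N. (\<Sum>i<N. complex_of_real (c i j) * v i) * complex_of_real (e j x))"
      by (subst sum.swap) (simp add: sum_distrib_right sum_distrib_left ac_simps)
    also have "\<dots> = r * w x" by (simp add: v(2) w_def sum_distrib_left mult.assoc)
    finally show ?thesis .
  qed
  have e_mean: "(\<integral>x. e j x \<partial>M) = 0" if j: "j < N" for j
  proof -
    have "(\<integral>x. e j x \<partial>M) = (\<integral>x. \<integral>y. p x y * e j y \<partial>M \<partial>M)"
      by (intro Bochner_Integration.integral_cong refl) (rule R_repr[OF eR[OF j]])
    also have "\<dots> = (\<integral>y. \<integral>x. p x y * e j y \<partial>M \<partial>M)"
      by (rule bdd_kernel_Fubini) (intro bdd_kernel_mult p bdd_kernel_snd R_bdd eR j)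
    also have "\<dots> = (\<integral>y. 0 \<partial>M)"
    proof (intro Bochner_Integration.integral_cong refl)
      fix y assume y: "y \<in> space M"
      have "(\<integral>x. p x y \<partial>M) = (\<integral>x. p y x \<partial>M)"
        by (intro Bochner_Integration.integral_cong refl) (simp add: p_sym y)
      then show "(\<integral>x. p x y * e j y \<partial>M) = 0" by (simp add: p_mean y)
    qed
    finally show ?thesis by simp
  qed
  \<comment> \<open>A constant is orthogonal to every \<open>e j\<close>, which has mean zero,
    whereas pairing \<open>w\<close> with \<open>e j\<close> returns \<open>v j\<close>. A constant
    \<open>w\<close> would make all coefficients zero.\<close>
  have "\<not> (AE x in M. w x = k)" for k
  proof
    assume k: "AE x in M. w x = k"
    have "v j = 0" if j: "j < N" for j
    proof -
      have "(\<integral>x. w x * complex_of_real (e j x) \<partial>M) = (\<integral>x. k * complex_of_real (e j x) \<partial>M)"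
        using k w_meas e_meas[OF j] by (intro integral_cong_AE) auto
      also have "\<dots> = 0" by (simp add: e_mean[OF j])
      finally have "(\<integral>x. w x * complex_of_real (e j x) \<partial>M) = 0" .
      moreover have "(\<integral>x. w x * complex_of_real (e j x) \<partial>M)
          = (\<integral>x. (\<Sum>i<N. v i * complex_of_real (e i x * e j x)) \<partial>M)"
        by (simp add: w_def sum_distrib_right mult.assoc)
      moreover have "\<dots> = (\<Sum>i<N. \<integral>x. v i * complex_of_real (e i x * e j x) \<partial>M)"
        by (intro Bochner_Integration.integral_sum integrable_mult_right integrable_of_real R_int eR j) simp
      moreover have "\<dots> = (\<Sum>i<N. v i * complex_of_real (ip (e i) (e j)))"
        by (simp only: ip_def integral_mult_right_zero integral_complex_of_real)
      moreover have "\<dots> = (\<Sum>i<N. if i = j then v i else 0)"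
        using j by (intro sum.cong) (auto simp: e_on)
      ultimately show ?thesis using j by simp
    qed
    with v(1) show False by blast
  qed
  with w_meas w_T that show ?thesis by blast
qed

end

section \<open>Ergodicity of the product from the constancy of eigenfunctions\<close>

context measure_preserving
begin

text \<open>The hypothesis concerns only functions that satisfy the eigenvalue equation at every
  point. The kernel built from \<open>C\<close> must be null, as it would otherwise yield a
  nonconstant function of this kind; hence \<open>C\<close> is independent of every rectangle and
  finally of itself.\<close>

lemma product_ergodic_of_eigenfunctions_constant:
  assumes eig: "\<And>(f :: 'a \<Rightarrow> complex) c. f \<in> borel_measurable M \<Longrightarrow>
      (\<And>x. x \<in> space M \<Longrightarrow> f (T x) = c * f x) \<Longrightarrow> \<exists>k. AE x in M. f x = k"
    and C: "C \<in> sets (M \<Otimes>\<^sub>M M)"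
    and C_inv: "\<And>x y. \<lbrakk>x \<in> space M; y \<in> space M\<rbrakk> \<Longrightarrow> (T x, T y) \<in> C \<longleftrightarrow> (x, y) \<in> C"
  shows "measure (M \<Otimes>\<^sub>M M) C = 0 \<or> measure (M \<Otimes>\<^sub>M M) C = 1"
proof -
  interpret P: pair_prob_space M M ..
  define k :: "'a \<Rightarrow> 'a \<Rightarrow> real" where "k x y = indicator C (x, y)" for x y
  define \<phi> where "\<phi> x = (\<integral>y. k x y \<partial>M)" for x
  \<comment> \<open>Subtracting the section measure \<open>\<phi> x\<close>, and not the constant
    \<open>m\<close>, makes the integral over y zero at every x. The variables of \<open>h\<close>
    both sit in this second argument of \<open>g\<close>, so \<open>h\<close> is symmetric and
    inherits mean zero exactly.\<close>
  define g where "g x y = k x y - \<phi> x" for x y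
  define h where "h = kernel_comp M (\<lambda>x y. g y x) g"
  define m where "m = P.prob C"
  have measure_iterated: "P.prob S = (\<integral>x. \<integral>y. indicator S (x, y) \<partial>M \<partial>M)" if "S \<in> sets (M \<Otimes>\<^sub>M M)" for S
  proof -
    have "P.prob S = (\<integral>p. indicator S p \<partial>(M \<Otimes>\<^sub>M M))"
      using that by (simp add: sets.Int_space_eq2)
    also have "\<dots> = (\<integral>x. \<integral>y. indicator S (x, y) \<partial>M \<partial>M)"
      using that by (intro P.integral_fst'[symmetric] P.bdd_fun_integrable bdd_fun_indicator)
    finally show ?thesis .
  qed
  have k: "bdd_kernel M k"
    using bdd_fun_indicator[OF C] by (simp add: bdd_kernel_def k_def case_prod_unfold)
  have k_inv: "k (T x) (T y) = k x y" if "x \<in> space M" "y \<in> space M" for x y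
    using C_inv[OF that] by (simp add: k_def indicator_def)
  have \<phi>: "bdd_fun M \<phi>" unfolding \<phi>_def by (rule bdd_kernel_integral[OF k])
  have \<phi>_inv: "\<phi> (T x) = \<phi> x" if x: "x \<in> space M" for x
  proof -
    have "\<phi> (T x) = (\<integral>y. k (T x) (T y) \<partial>M)"
      unfolding \<phi>_def
      by (rule integral_T[symmetric]) (rule bdd_fun_measurable[OF bdd_kernel_section(1)[OF k T_space[OF x]]])
    also have "\<dots> = \<phi> x"
      unfolding \<phi>_def by (intro Bochner_Integration.integral_cong refl) (simp add: k_inv x)
    finally show ?thesis .
  qed
  have m_int: "m = (\<integral>x. \<phi> x \<partial>M)"
    unfolding m_def \<phi>_def k_def by (rule measure_iterated[OF C])
  \<comment> \<open>\<open>\<phi>\<close> is invariant at every point, hence an eigenfunction with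
    eigenvalue 1.\<close>
  have \<phi>_ae: "AE x in M. \<phi> x = m"
  proof -
    have "\<exists>c. AE x in M. complex_of_real (\<phi> x) = c"
      using bdd_fun_measurable[OF \<phi>] \<phi>_inv by (intro eig[of _ 1]) auto
    then obtain c where c: "AE x in M. complex_of_real (\<phi> x) = c" by blast
    then have "AE x in M. \<phi> x = Re c" by (rule AE_mp) (auto intro!: AE_I2)
    moreover from this have "m = (\<integral>x. Re c \<partial>M)"
      unfolding m_int using bdd_fun_measurable[OF \<phi>] by (intro integral_cong_AE) auto
    ultimately show ?thesis by (simp add: prob_space)
  qed
  have g: "bdd_kernel M g"
    unfolding g_def by (intro bdd_kernel_diff k bdd_kernel_fst \<phi>)
  have g_inv: "g (T x) (T y) = g x y" if "x \<in> space M" "y \<in> space M" for x y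
    using that by (simp add: g_def k_inv \<phi>_inv)
  have g_mean: "(\<integral>y. g x y \<partial>M) = 0" if x: "x \<in> space M" for x
    using bdd_fun_integrable[OF bdd_kernel_section(1)[OF k x]] by (simp add: g_def \<phi>_def prob_space)
  have h: "bdd_kernel M h"
    unfolding h_def by (rule bdd_kernel_comp[OF bdd_kernel_transpose[OF g] g])
  have null: "rect_null M h"
  proof (rule ccontr)
    assume nn: "\<not> rect_null M h"
    interpret invariant_kernel M h T
    proof
      show "bdd_kernel M h" by (rule h)
      show "h x y = h y x" for x y by (simp add: h_def kernel_comp_def mult.commute)
      show "h (T x) (T y) = h x y" if xy: "x \<in> space M" "y \<in> space M" for x y
      proof -
        have "h (T x) (T y) = (\<integral>z. g (T z) (T x) * g (T z) (T y) \<partial>M)"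
          unfolding h_def kernel_comp_def
          by (rule integral_T[symmetric])
            (intro bdd_fun_measurable bdd_fun_mult bdd_kernel_section(2)[OF g] T_space xy)
        also have "\<dots> = h x y"
          unfolding h_def kernel_comp_def
          by (intro Bochner_Integration.integral_cong refl) (simp add: g_inv xy)
        finally show ?thesis .
      qed
      show "(\<integral>y. h x y \<partial>M) = 0" if x: "x \<in> space M" for x
      proof -
        have "(\<integral>y. h x y \<partial>M) = (\<integral>z. \<integral>y. g z x * g z y \<partial>M \<partial>M)"
          unfolding h_def kernel_comp_def
          by (rule bdd_kernel_Fubini[symmetric])
            (intro bdd_kernel_mult g bdd_kernel_fst bdd_kernel_section(2)[OF g x])
        also have "\<dots> = (\<integral>z. 0 \<partial>M)"
          by (intro Bochner_Integration.integral_cong refl) (simp add: g_mean)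
        finally show ?thesis by simp
      qed
    qed (rule nn)
    obtain w :: "'a \<Rightarrow> complex" and r where "w \<in> borel_measurable M"
      "\<And>x. x \<in> space M \<Longrightarrow> w (T x) = r * w x" "\<And>c. \<not> (AE x in M. w x = c)"
      by (rule eigenfunction_exists) blast
    with eig show False by blast
  qed
  have g_null: "rect_null M (\<lambda>x y. g y x)"
    by (rule rect_null_of_comp_transpose[OF bdd_kernel_transpose[OF g]])
      (use null in \<open>simp add: h_def kernel_comp_def[abs_def]\<close>)
  \<comment> \<open>Nullity of the centred kernel on a rectangle is independence of \<open>C\<close>
    from that rectangle, since \<open>\<phi>\<close> may be replaced by \<open>m\<close> under the
    integral.\<close>
  have rect: "P.prob (C \<inter> A \<times> B) = m * P.prob (A \<times> B)" if A: "A \<in> sets M" and B: "B \<in> sets M" for A B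
  proof -
    have kA: "integrable M (\<lambda>x. k x y * indicator A x)" if "y \<in> space M" for y
      by (intro bdd_fun_integrable bdd_fun_mult bdd_fun_indicator A bdd_kernel_section(2)[OF k that])
    have \<phi>A: "integrable M (\<lambda>x. \<phi> x * indicator A x)"
      by (intro bdd_fun_integrable bdd_fun_mult bdd_fun_indicator A \<phi>)
    have "(\<integral>x. \<phi> x * indicator A x \<partial>M) = (\<integral>x. m * indicator A x \<partial>M)"
      using \<phi>_ae bdd_fun_measurable[OF \<phi>] A by (intro integral_cong_AE) auto
    then have \<phi>A_eq: "(\<integral>x. \<phi> x * indicator A x \<partial>M) = m * prob A"
      using A by (simp add: sets.Int_space_eq2)
    have int: "integrable M (\<lambda>y. indicator B y * (\<integral>x. k x y * indicator A x \<partial>M))"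
      by (intro bdd_fun_integrable bdd_fun_mult bdd_fun_indicator B
          bdd_kernel_integral[OF bdd_kernel_transpose] bdd_kernel_mult k bdd_kernel_fst A)
    have "0 = (\<integral>y. indicator B y * (\<integral>x. g x y * indicator A x \<partial>M) \<partial>M)"
      using g_null A B by (simp add: rect_null_def)
    also have "\<dots> = (\<integral>y. indicator B y * (\<integral>x. k x y * indicator A x \<partial>M) - m * prob A * indicator B y \<partial>M)"
      by (intro Bochner_Integration.integral_cong refl)
        (simp add: g_def left_diff_distrib right_diff_distrib kA \<phi>A \<phi>A_eq)
    also have "\<dots> = (\<integral>y. indicator B y * (\<integral>x. k x y * indicator A x \<partial>M) \<partial>M) - m * prob A * prob B"
      using B by (subst Bochner_Integration.integral_diff[OF int])
        (auto simp: sets.Int_space_eq2 intro!: bdd_fun_integrable bdd_fun_intros)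
    finally have "(\<integral>y. \<integral>x. indicator B y * (k x y * indicator A x) \<partial>M \<partial>M) = m * prob A * prob B"
      by simp
    moreover have "(\<integral>y. \<integral>x. indicator B y * (k x y * indicator A x) \<partial>M \<partial>M)
        = (\<integral>x. \<integral>y. indicator B y * (k x y * indicator A x) \<partial>M \<partial>M)"
      by (rule bdd_kernel_Fubini[symmetric])
        (intro bdd_kernel_mult k bdd_kernel_fst bdd_kernel_snd bdd_fun_indicator A B)
    moreover have "\<dots> = P.prob (C \<inter> A \<times> B)"
      using A B C by (subst measure_iterated) (auto simp: k_def indicator_def intro!: Bochner_Integration.integral_cong)
    moreover have "P.prob (A \<times> B) = prob A * prob B"
      using emeasure_pair_measure_Times[OF A B] by (simp add: measure_def enn2real_mult)
    ultimately show ?thesis by simp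
  qed
  \<comment> \<open>Independence passes from rectangles to the generated sigma-algebra; the choice
    \<open>S = C\<close> then makes \<open>m\<close> its own square.\<close>
  have "P.prob (C \<inter> S) = m * P.prob S" if "S \<in> sets (M \<Otimes>\<^sub>M M)" for S
    using Int_stable_pair_measure_generator pair_measure_closed that unfolding sets_pair_measure
  proof (induct rule: sigma_sets_induct_disjoint)
    case (basic S)
    then show ?case using rect by auto
  next
    case empty
    then show ?case by simp
  next
    case (compl S)
    then have S: "S \<in> sets (M \<Otimes>\<^sub>M M)" by (simp add: sets_pair_measure)
    have "C \<inter> (space M \<times> space M - S) = C - C \<inter> S"
      using sets.sets_into_space[OF C] by (auto simp: space_pair_measure)
    then have "P.prob (C \<inter> (space M \<times> space M - S)) = m - P.prob (C \<inter> S)"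
      using C S by (simp add: m_def P.finite_measure_Diff)
    moreover have "P.prob (space M \<times> space M - S) = 1 - P.prob S"
      using P.prob_compl[OF S] by (simp add: space_pair_measure)
    ultimately show ?case using compl by (simp add: right_diff_distrib)
  next
    case (union F)
    then have F: "range F \<subseteq> sets (M \<Otimes>\<^sub>M M)" by (auto simp: sets_pair_measure)
    have "(\<lambda>i. P.prob (C \<inter> F i)) sums P.prob (\<Union>i. C \<inter> F i)"
      using F C union(1) by (intro P.finite_measure_UNION) (auto simp: disjoint_family_on_def)
    moreover have "(\<lambda>i. m * P.prob (F i)) sums (m * P.prob (\<Union>i. F i))"
      using F union(1) by (intro sums_mult P.finite_measure_UNION) auto
    ultimately show ?case using union(3) by (simp add: sums_unique2 Int_UN_distrib flip: Int_UN_distrib)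
  qed
  from this[OF C] have "m = m * m" by (simp add: m_def)
  then show ?thesis by (simp add: m_def)
qed

end

section \<open>Eigenfunctions of product-ergodic systems\<close>

text \<open>Almost every point avoids the countably many basic open sets of probability 0. Every
  open set around the value of \<open>X\<close> at such a point has probability 1, so two such
  values cannot be separated by disjoint open sets.\<close>

lemma (in prob_space) AE_const_of_zero_one:
  fixes X :: "'a \<Rightarrow> 'b::{second_countable_topology, t2_space}"
  assumes X [measurable]: "X \<in> borel_measurable M"
    and zero_one: "\<And>B. open B \<Longrightarrow> prob (X -` B \<inter> space M) = 0 \<or> prob (X -` B \<inter> space M) = 1"
  shows "\<exists>k. AE x in M. X x = k"
proof -
  obtain \<B> :: "'b set set" where \<B>: "countable \<B>" "topological_basis \<B>"
    using ex_countable_basis by blast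
  have X_sets: "X -` B \<inter> space M \<in> events" if "open B" for B
    using that by (intro measurable_sets[OF X]) auto
  define \<N> where "\<N> = {B \<in> \<B>. prob (X -` B \<inter> space M) = 0}"
  have "AE x in M. X x \<notin> B" if "B \<in> \<N>" for B
  proof (rule AE_I'[of "X -` B \<inter> space M"])
    have "open B" using that \<B>(2) by (simp add: \<N>_def topological_basis_open)
    then show "X -` B \<inter> space M \<in> null_sets M"
      using that X_sets by (intro null_setsI) (auto simp: \<N>_def emeasure_eq_measure)
  qed auto
  moreover have "countable \<N>" using \<B>(1) by (auto simp: \<N>_def intro: countable_subset)
  ultimately have ae: "AE x in M. \<forall>B\<in>\<N>. X x \<notin> B" by (simp add: AE_ball_countable)
  have "\<exists>a\<in>space M. \<forall>B\<in>\<N>. X a \<notin> B"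
  proof (rule ccontr)
    assume *: "\<not> ?thesis"
    have "AE x in M. False" using ae AE_space by eventually_elim (use * in blast)
    then show False by simp
  qed
  then obtain a where a: "a \<in> space M" "\<forall>B\<in>\<N>. X a \<notin> B" by blast
  have "X x = X a" if x: "x \<in> space M" "\<forall>B\<in>\<N>. X x \<notin> B" for x
  proof (rule ccontr)
    assume "X x \<noteq> X a"
    from hausdorff[OF this] obtain U W where UW: "open U" "open W" "X x \<in> U" "X a \<in> W" "U \<inter> W = {}"
      by blast
    have full: "prob (X -` S \<inter> space M) = 1"
      if S: "open S" "X z \<in> S" and z: "\<forall>B\<in>\<N>. X z \<notin> B" for S z
    proof -
      obtain B where B: "B \<in> \<B>" "X z \<in> B" "B \<subseteq> S"
        by (rule topological_basisE[OF \<B>(2) S]) blast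
      then have "B \<notin> \<N>" using z by blast
      then have "prob (X -` B \<inter> space M) = 1"
        using B(1) zero_one topological_basis_open[OF \<B>(2)] by (auto simp: \<N>_def)
      moreover have "prob (X -` B \<inter> space M) \<le> prob (X -` S \<inter> space M)"
        using B(3) X_sets[OF S(1)] by (intro finite_measure_mono) auto
      ultimately show ?thesis using prob_le_1[of "X -` S \<inter> space M"] by linarith
    qed
    have "prob ((X -` U \<inter> space M) \<union> (X -` W \<inter> space M)) = 1 + 1"
      using UW full x a X_sets by (subst finite_measure_Union) auto
    then show False using prob_le_1[of "(X -` U \<inter> space M) \<union> (X -` W \<inter> space M)"] by linarith
  qed
  note const = this
  have "AE x in M. X x = X a" using ae AE_space by eventually_elim (rule const)
  then show ?thesis by blast
qed

section \<open>Quotients of eigenfunctions on the product\<close>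

context measure_preserving
begin

lemma AE_T:
  assumes "AE x in M. Q x"
  shows "AE x in M. Q (T x)"
proof -
  obtain N where N: "N \<in> null_sets M" "{x \<in> space M. \<not> Q x} \<subseteq> N"
    using assms by (auto simp: eventually_ae_filter)
  have "T -` N \<inter> space M \<in> null_sets M"
  proof (rule null_setsI)
    have "N \<in> sets M" using N(1) by auto
    then show "T -` N \<inter> space M \<in> sets M" by (rule measurable_sets[OF T_measurable])
    have "emeasure M (T -` N \<inter> space M) = emeasure (distr M M T) N"
      using \<open>N \<in> sets M\<close> by (simp add: emeasure_distr)
    then show "emeasure M (T -` N \<inter> space M) = 0" using N(1) by (simp add: T_distr null_setsD1)
  qed
  then show ?thesis using N(2) T_space by (intro AE_I'[of "T -` N \<inter> space M"]) auto
qed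

lemma AE_T_all:
  assumes "AE x in M. Q x"
  shows "AE x in M. \<forall>n. Q ((T ^^ n) x)"
proof -
  have "AE x in M. Q ((T ^^ n) x)" for n
  proof (induction n)
    case (Suc n)
    from AE_T[OF this] show ?case by (simp add: funpow_swap1)
  qed (simp add: assms)
  then show ?thesis by (simp add: AE_all_countable)
qed

text \<open>The quotient f x / f y is invariant only almost everywhere, whereas \<open>erg\<close>
  concerns strictly invariant sets. Asking that the quotient lie in \<open>B\<close> from some time
  on along the orbit gives such a set, equal almost everywhere to the preimage of \<open>B\<close>;
  there the factors \<open>c ^ n\<close> cancel.\<close>

lemma eigenfunction_constant_of_product_ergodic:
  fixes f :: "'a \<Rightarrow> complex"
  assumes erg: "\<And>C. C \<in> sets (M \<Otimes>\<^sub>M M) \<Longrightarrow> map_prod T T -` C \<inter> space (M \<Otimes>\<^sub>M M) = C \<Longrightarrow>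
      measure (M \<Otimes>\<^sub>M M) C = 0 \<or> measure (M \<Otimes>\<^sub>M M) C = 1"
    and f [measurable]: "f \<in> borel_measurable M"
    and eig: "AE x in M. f (T x) = c * f x" and c: "c \<noteq> 0"
  shows "\<exists>k. AE x in M. f x = k"
proof -
  interpret P: pair_prob_space M M ..
  define good where "good x \<longleftrightarrow> (\<forall>n. f (T ((T ^^ n) x)) = c * f ((T ^^ n) x))" for x
  have good_ae: "AE x in M. good x"
    unfolding good_def by (rule AE_T_all[OF eig])
  have good_pow: "f ((T ^^ n) x) = c ^ n * f x" if "good x" for n x
    using that by (induction n) (auto simp: good_def)
  define g where "g p = f (fst p) / f (snd p)" for p
  have g_meas [measurable]: "g \<in> borel_measurable (M \<Otimes>\<^sub>M M)"
    unfolding g_def by measurable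
  have ae_pair: "AE p in M \<Otimes>\<^sub>M M. good (fst p) \<and> good (snd p)"
  proof (rule P.AE_pair_measure)
    have [measurable]: "(\<lambda>x. (T ^^ n) x) \<in> M \<rightarrow>\<^sub>M M" for n using measurable_compose_n[OF T_measurable] .
    show "{p \<in> space (M \<Otimes>\<^sub>M M). good (fst p) \<and> good (snd p)} \<in> sets (M \<Otimes>\<^sub>M M)"
      unfolding good_def by measurable
    show "AE x in M. AE y in M. good (fst (x, y)) \<and> good (snd (x, y))"
      using good_ae by eventually_elim (use good_ae in simp)
  qed
  have "\<exists>k. AE p in M \<Otimes>\<^sub>M M. g p = k"
  proof (rule P.AE_const_of_zero_one[OF g_meas])
    fix B :: "complex set" assume B: "open B"
    define C where "C = {p \<in> space (M \<Otimes>\<^sub>M M).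
      \<exists>N. \<forall>n\<ge>N. g ((T ^^ n) (fst p), (T ^^ n) (snd p)) \<in> B}"
    have [measurable]: "(\<lambda>x. (T ^^ n) x) \<in> M \<rightarrow>\<^sub>M M" for n using measurable_compose_n[OF T_measurable] .
    have [measurable]: "B \<in> sets borel" using B by simp
    have C: "C \<in> sets (M \<Otimes>\<^sub>M M)" unfolding C_def by measurable
    have shift: "(\<exists>N. \<forall>n\<ge>N. R (Suc n)) \<longleftrightarrow> (\<exists>N. \<forall>n\<ge>N. R n)" for R :: "nat \<Rightarrow> bool"
      by (simp only: eventually_sequentially[symmetric] eventually_sequentially_Suc)
    have "(T a, T b) \<in> C \<longleftrightarrow> (a, b) \<in> C" if "a \<in> space M" "b \<in> space M" for a b
      unfolding C_def using that shift[of "\<lambda>n. g ((T ^^ n) a, (T ^^ n) b) \<in> B"]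
      by (simp add: funpow_Suc_right space_pair_measure T_space del: funpow.simps)
    then have C_inv: "map_prod T T -` C \<inter> space (M \<Otimes>\<^sub>M M) = C"
      using sets.sets_into_space[OF C] by (auto simp: space_pair_measure)
    have "AE p in M \<Otimes>\<^sub>M M. p \<in> C \<longleftrightarrow> p \<in> g -` B \<inter> space (M \<Otimes>\<^sub>M M)"
      using ae_pair
    proof (rule AE_mp, intro AE_I2 impI)
      fix p assume p: "p \<in> space (M \<Otimes>\<^sub>M M)" "good (fst p) \<and> good (snd p)"
      have "g ((T ^^ n) (fst p), (T ^^ n) (snd p)) = g p" for n
        using p(2) c by (simp add: g_def good_pow)
      then show "p \<in> C \<longleftrightarrow> p \<in> g -` B \<inter> space (M \<Otimes>\<^sub>M M)" using p(1) by (auto simp: C_def)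
    qed
    then have "P.prob C = P.prob (g -` B \<inter> space (M \<Otimes>\<^sub>M M))"
      using C by (intro P.finite_measure_eq_AE) auto
    with erg[OF C C_inv] show "P.prob (g -` B \<inter> space (M \<Otimes>\<^sub>M M)) = 0 \<or> P.prob (g -` B \<inter> space (M \<Otimes>\<^sub>M M)) = 1"
      by simp
  qed
  then obtain k where "AE p in M \<Otimes>\<^sub>M M. g p = k" by blast
  from P.AE_pair[OF this] have ae: "AE x in M. AE y in M. f x / f y = k" by (simp add: g_def)
  show ?thesis
  proof (cases "AE x in M. f x = 0")
    case False
    have "\<exists>x. (AE y in M. f x / f y = k) \<and> f x \<noteq> 0"
    proof (rule ccontr)
      assume none: "\<not> ?thesis"
      have "AE x in M. f x = 0" using ae by eventually_elim (use none in blast)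
      with False show False by simp
    qed
    then obtain x where x: "AE y in M. f x / f y = k" "f x \<noteq> 0" by blast
    \<comment> \<open>For \<open>k = 0\<close> both sides vanish, by the convention \<open>z / 0 = 0\<close>.\<close>
    have "AE y in M. f y = f x / k"
      using x(1) by eventually_elim (use x(2) in auto)
    then show ?thesis by blast
  qed blast
qed

end

section \<open>Upper probabilities and their cores\<close>

text \<open>The family that repeats the empty set is disjoint, and a constant series converges only
  if its term is 0.\<close>

lemma prob_fun_empty:
  assumes "prob_fun M P" shows "P {} = 0"
proof -
  have "(\<lambda>n::nat. P {}) sums P (\<Union>(range (\<lambda>n::nat. {})))"
    using assms unfolding prob_fun_def by (elim conjE allE[of _ "\<lambda>n::nat. {}"]) (auto simp: disjoint_family_on_def)
  then have "summable (\<lambda>n::nat. P {})" by (rule sums_summable)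
  then show ?thesis by (simp add: summable_const_iff)
qed

lemma fun_measure_basic [simp]:
  "sets (fun_measure M P) = sets M" "space (fun_measure M P) = space M"
  by (simp_all add: fun_measure_def)

lemma emeasure_fun_measure:
  assumes P: "prob_fun M P" and A: "A \<in> sets M"
  shows "emeasure (fun_measure M P) A = ennreal (P A)"
  unfolding fun_measure_def
proof (rule emeasure_measure_of_sigma[OF sets.sigma_algebra_axioms _ _ A])
  show "positive (sets M) (\<lambda>A. ennreal (P A))"
    using prob_fun_empty[OF P] by (simp add: positive_def)
  show "countably_additive (sets M) (\<lambda>A. ennreal (P A))"
  proof (rule countably_additiveI)
    fix F :: "nat \<Rightarrow> 'a set" assume F: "range F \<subseteq> sets M" "disjoint_family F"
    have s: "(\<lambda>n. P (F n)) sums P (\<Union>(range F))" using P F by (simp add: prob_fun_def)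
    have nn: "0 \<le> P (F n)" for n using P F(1) by (auto simp: prob_fun_def)
    show "(\<Sum>n. ennreal (P (F n))) = ennreal (P (\<Union>(range F)))"
      using suminf_ennreal2[OF nn sums_summable[OF s]] sums_unique[OF s] by simp
  qed
qed

lemma prob_space_fun_measure: "prob_fun M P \<Longrightarrow> prob_space (fun_measure M P)"
  by (rule prob_spaceI) (simp add: emeasure_fun_measure, simp add: prob_fun_def)

lemma measure_fun_measure: "prob_fun M P \<Longrightarrow> A \<in> sets M \<Longrightarrow> measure (fun_measure M P) A = P A"
  by (simp add: measure_def emeasure_fun_measure prob_fun_def)

lemma measure_preserving_fun_measure:
  assumes T: "T \<in> M \<rightarrow>\<^sub>M M" and P: "prob_fun M P" and inv: "T_invariant_fun M T P"
  shows "measure_preserving (fun_measure M P) T"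
proof -
  interpret prob_space "fun_measure M P" by (rule prob_space_fun_measure[OF P])
  have T': "T \<in> fun_measure M P \<rightarrow>\<^sub>M fun_measure M P"
    using T by (simp cong: measurable_cong_sets)
  show ?thesis
  proof
    show "distr (fun_measure M P) (fun_measure M P) T = fun_measure M P"
    proof (rule measure_eqI)
      fix A assume "A \<in> sets (distr (fun_measure M P) (fun_measure M P) T)"
      then have A: "A \<in> sets M" by simp
      then show "emeasure (distr (fun_measure M P) (fun_measure M P) T) A = emeasure (fun_measure M P) A"
        using T' measurable_sets[OF T A] inv P
        by (simp add: emeasure_distr emeasure_fun_measure T_invariant_fun_def)
    qed simp
  qed (rule T')
qed

text \<open>What finite additivity leaves open is the mass of the tails of a disjoint union. These
  decrease to the empty set, and \<open>V\<close> dominates their mass.\<close>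

lemma prob_fun_of_continuous_at_empty:
  assumes P: "P \<in> core M V"
    and cont: "\<And>A :: nat \<Rightarrow> 'a set. range A \<subseteq> sets M \<Longrightarrow> decseq A \<Longrightarrow> (\<Inter>n. A n) = {} \<Longrightarrow>
      (\<lambda>n. V (A n)) \<longlonglongrightarrow> 0"
  shows "prob_fun M P"
proof -
  have add: "P (A \<union> B) = P A + P B" if "A \<in> sets M" "B \<in> sets M" "A \<inter> B = {}" for A B
    using P that by (simp add: core_def)
  have nonneg: "0 \<le> P A" and le: "P A \<le> V A" if "A \<in> sets M" for A
    using P that by (simp_all add: core_def)
  have empty: "P {} = 0" using add[of "{}" "{}"] by simp
  have "(\<lambda>n. P (F n)) sums P (\<Union>(range F))" if F: "range F \<subseteq> sets M" "disjoint_family F" for F :: "nat \<Rightarrow> 'a set"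
  proof -
    define A where "A n = (\<Union>i\<in>{n..}. F i)" for n
    have A_sets: "A n \<in> sets M" for n unfolding A_def using F(1) by auto
    have F_sets: "F n \<in> sets M" for n using F(1) by auto
    have A_Suc: "A n = F n \<union> A (Suc n)" for n
    proof -
      have "{n..} = insert n {Suc n..}" by auto
      then show ?thesis by (simp add: A_def)
    qed
    have disj: "F n \<inter> A (Suc n) = {}" for n
    proof -
      have "F n \<inter> F i = {}" if "Suc n \<le> i" for i
        using disjoint_family_onD[OF F(2), of n i] that by simp
      then show ?thesis by (auto simp: A_def)
    qed
    have sum: "P (\<Union>(range F)) = (\<Sum>i<n. P (F i)) + P (A n)" for n
    proof (induction n)
      case (Suc n)
      then show ?case using A_Suc[of n] add[OF F_sets A_sets disj, of n] by simp
    qed (simp add: A_def)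
    have "(\<Inter>n. A n) = {}"
    proof (rule equals0I)
      fix x assume x: "x \<in> (\<Inter>n. A n)"
      then obtain i where i: "x \<in> F i" by (auto simp: A_def)
      from x have "x \<in> A (Suc i)" by blast
      with i disj[of i] show False by blast
    qed
    moreover have "decseq A" unfolding A_def decseq_def by (intro allI impI UN_mono) auto
    ultimately have V: "(\<lambda>n. V (A n)) \<longlonglongrightarrow> 0" using A_sets by (intro cont) auto
    have "(\<lambda>n. P (A n)) \<longlonglongrightarrow> 0"
      by (rule tendsto_sandwich[OF _ _ tendsto_const V]) (auto simp: nonneg le A_sets)
    then have "(\<lambda>n. P (\<Union>(range F)) - P (A n)) \<longlonglongrightarrow> P (\<Union>(range F)) - 0"
      by (intro tendsto_diff tendsto_const)
    moreover have "(\<lambda>n. P (\<Union>(range F)) - P (A n)) = (\<lambda>n. \<Sum>i<n. P (F i))"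
    proof
      fix n show "P (\<Union>(range F)) - P (A n) = (\<Sum>i<n. P (F i))" using sum[of n] by linarith
    qed
    ultimately show ?thesis by (simp add: sums_def)
  qed
  with P show ?thesis by (simp add: prob_fun_def core_def)
qed

text \<open>Dini's argument: on the compact set of probabilities defining \<open>V\<close>, pointwise decreasing
  convergence to zero is uniform.\<close>
lemma upper_prob_continuous_at_empty:
  fixes A :: "nat \<Rightarrow> 'a set"
  assumes V: "upper_prob M V" and A: "range A \<subseteq> sets M" "decseq A" "(\<Inter>n. A n) = {}"
  shows "(\<lambda>n. V (A n)) \<longlonglongrightarrow> 0"
proof -
  from V obtain \<Lambda> where \<Lambda>: "\<Lambda> \<subseteq> {P. prob_fun M P}" "compact \<Lambda>"
    and max: "\<And>B. B \<in> sets M \<Longrightarrow> \<exists>P\<in>\<Lambda>. P B = V B"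
    unfolding upper_prob_def by blast
  have A_sets: "A n \<in> sets M" for n using A(1) by auto
  have mono: "P (A n) \<le> P (A m)" if P: "P \<in> \<Lambda>" and "m \<le> n" for P m n
  proof -
    have pf: "prob_fun M P" using \<Lambda>(1) P by auto
    interpret prob_space "fun_measure M P" by (rule prob_space_fun_measure[OF pf])
    have "prob (A n) \<le> prob (A m)"
      using decseqD[OF A(2) \<open>m \<le> n\<close>] A_sets by (intro finite_measure_mono) auto
    then show ?thesis by (simp add: measure_fun_measure[OF pf] A_sets)
  qed
  have lim: "(\<lambda>n. P (A n)) \<longlonglongrightarrow> 0" if P: "P \<in> \<Lambda>" for P
  proof -
    have pf: "prob_fun M P" using \<Lambda>(1) P by auto
    interpret prob_space "fun_measure M P" by (rule prob_space_fun_measure[OF pf])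
    have "(\<lambda>n. prob (A n)) \<longlonglongrightarrow> prob (\<Inter>n. A n)"
      using A A_sets by (intro finite_Lim_measure_decseq) auto
    then show ?thesis by (simp add: measure_fun_measure[OF pf] A_sets A(3))
  qed
  show ?thesis
  proof (rule LIMSEQ_I)
    fix e :: real assume e: "0 < e"
    have "\<exists>D\<subseteq>UNIV. finite D \<and> \<Lambda> \<subseteq> (\<Union>n\<in>D. {P. P (A n) < e})"
    proof (rule compactE_image[OF \<Lambda>(2), of UNIV "\<lambda>n. {P. P (A n) < e}"])
      show "open {P :: 'a set \<Rightarrow> real. P (A n) < e}" for n
        by (rule open_Collect_less) (auto intro: continuous_on_product_coordinates)
      show "\<Lambda> \<subseteq> (\<Union>n\<in>UNIV. {P. P (A n) < e})"
      proof
        fix P assume P: "P \<in> \<Lambda>"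
        obtain n where "\<bar>P (A n) - 0\<bar> < e" using LIMSEQ_D[OF lim[OF P] e] by force
        then have "P (A n) < e" by linarith
        then show "P \<in> (\<Union>n\<in>UNIV. {P. P (A n) < e})" by blast
      qed
    qed blast
    then obtain D where D: "finite D" "\<Lambda> \<subseteq> (\<Union>n\<in>D. {P. P (A n) < e})" by blast
    \<comment> \<open>The probability attaining \<open>V (A n)\<close> varies with n, but it is
      small on some \<open>A d\<close> with d in the finite set \<open>D\<close>, and
      \<open>A n\<close> is contained in \<open>A d\<close>.\<close>
    have "norm (V (A n) - 0) < e" if n: "Max (insert 0 D) \<le> n" for n
    proof -
      obtain P where P: "P \<in> \<Lambda>" "P (A n) = V (A n)" using max[OF A_sets] by blast
      then obtain d where d: "d \<in> D" "P (A d) < e" using D(2) by blast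
      have "d \<le> n" using n Max_ge[of "insert 0 D" d] D(1) d(1) by simp
      from mono[OF P(1) this] d(2) have "P (A n) < e" by linarith
      moreover have "0 \<le> P (A n)" using \<Lambda>(1) P(1) A_sets by (auto simp: prob_fun_def)
      ultimately show ?thesis using P(2) by simp
    qed
    then show "\<exists>N. \<forall>n\<ge>N. norm (V (A n) - 0) < e" by blast
  qed
qed

lemma core_prob_fun: "upper_prob M V \<Longrightarrow> P \<in> core M V \<Longrightarrow> prob_fun M P"
  by (rule prob_fun_of_continuous_at_empty) (auto intro: upper_prob_continuous_at_empty)

lemma prob_fun_core:
  assumes P: "prob_fun M P" and le: "\<And>A. A \<in> sets M \<Longrightarrow> P A \<le> V A"
  shows "P \<in> core M V"
proof -
  interpret prob_space "fun_measure M P" by (rule prob_space_fun_measure[OF P])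
  have "P (A \<union> B) = P A + P B" if "A \<in> sets M" "B \<in> sets M" "A \<inter> B = {}" for A B
    using finite_measure_Union[of A B] that measure_fun_measure[OF P] by simp
  then show ?thesis using P le by (simp add: core_def prob_fun_def)
qed

lemma upper_prob_attained:
  assumes "upper_prob M V" "A \<in> sets M"
  obtains P where "P \<in> core M V" "P A = V A"
proof -
  from assms(1) obtain \<Lambda> where \<Lambda>: "\<Lambda> \<subseteq> {P. prob_fun M P}"
    and le: "\<And>B P. B \<in> sets M \<Longrightarrow> P \<in> \<Lambda> \<Longrightarrow> P B \<le> V B"
    and max: "\<And>B. B \<in> sets M \<Longrightarrow> \<exists>P\<in>\<Lambda>. P B = V B"
    unfolding upper_prob_def by blast
  obtain P where P: "P \<in> \<Lambda>" "P A = V A" using max[OF assms(2)] by blast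
  have "P \<in> core M V" by (rule prob_fun_core) (use \<Lambda> P(1) le in auto)
  with P(2) that show ?thesis by blast
qed

lemma upper_prob_null_iff:
  assumes V: "upper_prob M V" and A: "A \<in> sets M"
  shows "V A = 0 \<longleftrightarrow> (\<forall>P\<in>core M V. P A = 0)"
proof
  assume "V A = 0"
  then show "\<forall>P\<in>core M V. P A = 0" using A by (fastforce simp: core_def)
next
  assume *: "\<forall>P\<in>core M V. P A = 0"
  obtain P where "P \<in> core M V" "P A = V A" by (rule upper_prob_attained[OF V A]) blast
  with * show "V A = 0" by metis
qed

lemma upper_prob_empty: "upper_prob M V \<Longrightarrow> V {} = 0"
  using core_prob_fun prob_fun_empty by (fastforce simp: upper_prob_null_iff)

text \<open>A set is null for \<open>V\<close> exactly when it is null for every member of the core.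
  Measurability of the set where \<open>R\<close> holds provides one exceptional set common to all
  members.\<close>

lemma cap_ae_upper_prob_iff:
  assumes V: "upper_prob M V" and R: "{x \<in> space M. R x} \<in> sets M"
  shows "cap_ae M V R \<longleftrightarrow> (\<forall>P\<in>core M V. AE x in fun_measure M P. R x)"
proof
  assume "cap_ae M V R"
  then obtain A where A: "A \<in> sets M" "V (space M - A) = 0" "\<forall>x\<in>A. R x" by (auto simp: cap_ae_def)
  show "\<forall>P\<in>core M V. AE x in fun_measure M P. R x"
  proof
    fix P assume P: "P \<in> core M V"
    have "P (space M - A) = 0" using upper_prob_null_iff[OF V, of "space M - A"] A P by auto
    then show "AE x in fun_measure M P. R x"
      using A core_prob_fun[OF V P] by (intro AE_I[of _ _ "space M - A"]) (auto simp: emeasure_fun_measure)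
  qed
next
  assume *: "\<forall>P\<in>core M V. AE x in fun_measure M P. R x"
  have N: "space M - {x \<in> space M. R x} \<in> sets M" using R by auto
  have "P (space M - {x \<in> space M. R x}) = 0" if P: "P \<in> core M V" for P
  proof -
    have pf: "prob_fun M P" by (rule core_prob_fun[OF V P])
    interpret prob_space "fun_measure M P" by (rule prob_space_fun_measure[OF pf])
    have "prob {x \<in> space (fun_measure M P). R x} = 1"
      using * P R by (subst prob_Collect_eq_1) auto
    then show ?thesis
      using prob_compl[of "{x \<in> space M. R x}"] R N by (simp add: measure_fun_measure[OF pf])
  qed
  then have "V (space M - {x \<in> space M. R x}) = 0" by (simp add: upper_prob_null_iff[OF V N])
  then show "cap_ae M V R" using R unfolding cap_ae_def by (intro bexI[of _ "{x \<in> space M. R x}"]) auto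
qed

section \<open>Invariant members of the core and their uniqueness\<close>

lemma compact_box: "compact {P :: 'a \<Rightarrow> real. \<forall>A. P A \<in> {0..1}}"
proof -
  have "compactin (product_topology (\<lambda>_ :: 'a. euclidean) UNIV) (PiE UNIV (\<lambda>_. {0..1::real}))"
    by (simp add: compactin_PiE)
  moreover have "PiE UNIV (\<lambda>_. {0..1::real}) = {P :: 'a \<Rightarrow> real. \<forall>A. P A \<in> {0..1}}"
    by (auto simp: PiE_def Pi_def)
  ultimately show ?thesis by (simp add: euclidean_product_topology)
qed

text \<open>Krylov--Bogoliubov: a cluster point of the Cesaro averages of the push-forwards of any
  element of the core.\<close>
lemma invariant_core_exists:
  assumes T: "T \<in> M \<rightarrow>\<^sub>M M" and V_inv: "T_invariant_fun M T V" and P0: "P0 \<in> core M V"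
    and V_le: "\<And>A. A \<in> sets M \<Longrightarrow> V A \<le> 1"
  obtains Q where "Q \<in> core M V" "T_invariant_fun M T Q"
proof -
  have Tn: "T ^^ n \<in> M \<rightarrow>\<^sub>M M" for n using measurable_compose_n[OF T] .
  have pre: "(T ^^ n) -` A \<inter> space M \<in> sets M" if "A \<in> sets M" for n A
    by (rule measurable_sets[OF Tn that])
  have pre_Suc: "(T ^^ Suc n) -` A \<inter> space M = T -` ((T ^^ n) -` A \<inter> space M) \<inter> space M" for n A
    using measurable_space[OF T] by (auto simp: funpow_Suc_right simp del: funpow.simps)
  have pre_Suc': "(T ^^ Suc n) -` A \<inter> space M = (T ^^ n) -` (T -` A \<inter> space M) \<inter> space M" for n A
    using measurable_space[OF Tn] by auto
  have V_pre: "V ((T ^^ n) -` A \<inter> space M) = V A" if A: "A \<in> sets M" for n A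
  proof (induction n)
    case 0
    then show ?case using sets.sets_into_space[OF A] by (simp add: Int_absorb2)
  next
    case (Suc n)
    then show ?case
      using V_inv[unfolded T_invariant_fun_def, rule_format, OF pre[OF A, of n]] by (simp only: pre_Suc)
  qed
  define push where "push n A = (if A \<in> sets M then P0 ((T ^^ n) -` A \<inter> space M) else 0)" for n A
  have push: "push n \<in> core M V" for n
    unfolding core_def
  proof (intro CollectI conjI allI ballI impI)
    show "push n (space M) = 1"
    proof -
      have "(T ^^ n) -` space M \<inter> space M = space M" using measurable_space[OF Tn] by auto
      then show ?thesis using P0 by (simp add: push_def core_def)
    qed
    show "push n (A \<union> B) = push n A + push n B" if AB: "A \<in> sets M" "B \<in> sets M" "A \<inter> B = {}" for A B
    proof -
      have "(T ^^ n) -` (A \<union> B) \<inter> space M = ((T ^^ n) -` A \<inter> space M) \<union> ((T ^^ n) -` B \<inter> space M)" by auto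
      moreover have "((T ^^ n) -` A \<inter> space M) \<inter> ((T ^^ n) -` B \<inter> space M) = {}" using AB(3) by auto
      ultimately show ?thesis using P0 AB pre[OF AB(1), of n] pre[OF AB(2), of n] by (simp add: push_def core_def)
    qed
    show "push n A \<le> V A" if "A \<in> sets M" for A
    proof -
      have "push n A \<le> V ((T ^^ n) -` A \<inter> space M)" using P0 pre[OF that] that by (simp add: push_def core_def)
      then show ?thesis by (simp add: V_pre[OF that])
    qed
    show "0 \<le> push n A" if "A \<in> sets M" for A
      using P0 pre[OF that] that by (simp add: push_def core_def)
  qed (simp add: push_def)
  define avg where "avg n A = (\<Sum>k<Suc n. push k A) / Suc n" for n A
  have avg: "avg n \<in> core M V" for n
    unfolding core_def
  proof (intro CollectI conjI allI ballI impI)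
    have c: "push k \<in> core M V" for k by (rule push)
    show "avg n A = 0" if "A \<notin> sets M" for A using c that by (simp add: avg_def core_def)
    show "0 \<le> avg n A" if "A \<in> sets M" for A
      unfolding avg_def using c that by (intro divide_nonneg_nonneg sum_nonneg) (auto simp: core_def)
    show "avg n (space M) = 1" using c by (simp add: avg_def core_def del: sum.lessThan_Suc)
    show "avg n (A \<union> B) = avg n A + avg n B" if "A \<in> sets M" "B \<in> sets M" "A \<inter> B = {}" for A B
      using c that by (simp add: avg_def core_def sum.distrib add_divide_distrib del: sum.lessThan_Suc)
    show "avg n A \<le> V A" if "A \<in> sets M" for A
    proof -
      have "(\<Sum>k<Suc n. push k A) \<le> (\<Sum>k<Suc n. V A)"
        using c that by (intro sum_mono) (auto simp: core_def)
      then show ?thesis by (simp add: avg_def field_simps)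
    qed
  qed
  have core01: "P A \<in> {0..1}" if "P \<in> core M V" for P A
    using that V_le[of A] by (cases "A \<in> sets M") (force simp: core_def)+
  \<comment> \<open>The difference telescopes to the last and the initial push-forward, both with
    values in [0, 1], divided by the number \<open>Suc n\<close> of terms.\<close>
  have avg_T: "(\<lambda>n. avg n (T -` A \<inter> space M) - avg n A) \<longlonglongrightarrow> 0" if A: "A \<in> sets M" for A
  proof (rule tendsto_0_le[where K = 1])
    show "(\<lambda>n. 1 / real (Suc n)) \<longlonglongrightarrow> 0" by (rule LIMSEQ_Suc[OF lim_1_over_n])
    have TA: "T -` A \<inter> space M \<in> sets M" by (rule measurable_sets[OF T A])
    have "push k (T -` A \<inter> space M) = push (Suc k) A" for k
      using A TA by (simp only: push_def pre_Suc' if_True)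
    then have "avg n (T -` A \<inter> space M) - avg n A = (\<Sum>k<Suc n. push (Suc k) A - push k A) / Suc n" for n
      by (simp add: avg_def sum_subtractf diff_divide_distrib del: sum.lessThan_Suc)
    then have "avg n (T -` A \<inter> space M) - avg n A = (push (Suc n) A - push 0 A) / Suc n" for n
      by (simp only: sum_lessThan_telescope[of "\<lambda>k. push k A"])
    moreover have "\<bar>push (Suc n) A - push 0 A\<bar> \<le> 1" for n
      using core01[OF push[of "Suc n"], of A] core01[OF push[of 0], of A] by auto
    ultimately show "\<forall>\<^sub>F n in sequentially. norm (avg n (T -` A \<inter> space M) - avg n A) \<le> norm (1 / real (Suc n)) * 1"
      by (simp add: abs_divide divide_right_mono)
  qed
  \<comment> \<open>The set functions live in a product over possibly uncountably many sets, where
    compactness need not give convergent subsequences. The cluster point is therefore described by a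
    proper filter \<open>G\<close> below both \<open>F\<close> and the neighbourhood filter of
    \<open>Q\<close>.\<close>
  define F where "F = filtermap avg sequentially"
  have F_core: "\<forall>\<^sub>F P in F. P \<in> core M V" by (simp add: F_def eventually_filtermap avg)
  have "F \<noteq> bot" by (simp add: F_def filtermap_bot_iff)
  moreover have "\<forall>\<^sub>F P in F. P \<in> {P. \<forall>A. P A \<in> {0..1}}"
    using F_core by eventually_elim (use core01 in blast)
  ultimately obtain Q where Q: "inf (nhds Q) F \<noteq> bot"
    using compact_box[where 'a = "'a set"] unfolding compact_filter by blast
  define G where "G = inf (nhds Q) F"
  have G: "G \<noteq> bot" "G \<le> nhds Q" "G \<le> F" using Q by (simp_all add: G_def)
  have G_core: "\<forall>\<^sub>F P in G. P \<in> core M V" using F_core G(3) by (rule filter_leD[rotated])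
  have lim: "((\<lambda>P. P A) \<longlongrightarrow> Q A) G" for A
  proof -
    have "((\<lambda>P. P A) \<longlongrightarrow> Q A) (nhds Q)"
    proof (rule topological_tendstoI)
      fix S :: "real set" assume S: "open S" "Q A \<in> S"
      have "open ((\<lambda>P :: 'a set \<Rightarrow> real. P A) -` S)"
        by (rule open_vimage[OF S(1) continuous_on_product_coordinates])
      then show "\<forall>\<^sub>F P in nhds Q. P A \<in> S"
        using S(2) unfolding eventually_nhds by (intro exI[of _ "(\<lambda>P. P A) -` S"]) auto
    qed
    then show ?thesis using G(2) by (rule tendsto_mono[rotated])
  qed
  have lim_eq: "a = b" if "(f \<longlongrightarrow> a) G" "(g \<longlongrightarrow> b) G" "\<And>P. P \<in> core M V \<Longrightarrow> f P = g P" for f g and a b :: real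
  proof -
    have "\<forall>\<^sub>F P in G. f P = g P" using G_core by eventually_elim (rule that(3))
    with that(1) have "(g \<longlongrightarrow> a) G" by (rule Lim_transform_eventually)
    then show ?thesis using that(2) G(1) by (intro tendsto_unique)
  qed
  have lim_le: "a \<le> b" if "(f \<longlongrightarrow> a) G" "(g \<longlongrightarrow> b) G" "\<And>P. P \<in> core M V \<Longrightarrow> f P \<le> g P" for f g and a b :: real
    using G(1) that(2,1) by (rule tendsto_le) (use G_core that(3) in \<open>auto elim: eventually_mono\<close>)
  \<comment> \<open>Each condition in \<open>core\<close> involves finitely many values of the set
    function and so survives the limit. Countable additivity of the limit is recovered afterwards
    from the continuity of \<open>V\<close> at the empty set.\<close>
  have "Q \<in> core M V"
    unfolding core_def
  proof (intro CollectI conjI allI ballI impI)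
    show "Q A = 0" if "A \<notin> sets M" for A
      by (rule lim_eq[OF lim tendsto_const]) (use that in \<open>simp add: core_def\<close>)
    show "0 \<le> Q A" if "A \<in> sets M" for A
      by (rule lim_le[OF tendsto_const lim]) (use that in \<open>simp add: core_def\<close>)
    show "Q (space M) = 1"
      by (rule lim_eq[OF lim tendsto_const]) (simp add: core_def)
    show "Q (A \<union> B) = Q A + Q B" if "A \<in> sets M" "B \<in> sets M" "A \<inter> B = {}" for A B
      by (rule lim_eq[OF lim tendsto_add[OF lim lim]]) (use that in \<open>simp add: core_def\<close>)
    show "Q A \<le> V A" if "A \<in> sets M" for A
      by (rule lim_le[OF lim tendsto_const]) (use that in \<open>simp add: core_def\<close>)
  qed
  moreover have "Q (T -` A \<inter> space M) = Q A" if A: "A \<in> sets M" for A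
  proof -
    have "((\<lambda>P. P (T -` A \<inter> space M) - P A) \<longlongrightarrow> 0) F"
      using avg_T[OF A] by (simp add: F_def filterlim_filtermap)
    then have "((\<lambda>P. P (T -` A \<inter> space M) - P A) \<longlongrightarrow> 0) G" using G(3) by (rule tendsto_mono[rotated])
    from tendsto_unique[OF G(1) tendsto_diff[OF lim lim] this] show ?thesis by simp
  qed
  ultimately show ?thesis using that by (simp add: T_invariant_fun_def)
qed

text \<open>If \<open>Y\<close> is a positive Hahn set of the invariant signed measure \<open>Q1 - Q2\<close>, then the
  invariant set of points visiting \<open>Y\<close> infinitely often also maximises it, hence the maximum is 0.\<close>
lemma invariant_prob_fun_eqI:
  assumes T: "T \<in> M \<rightarrow>\<^sub>M M" and Q1: "prob_fun M Q1" and Q2: "prob_fun M Q2"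
    and inv: "T_invariant_fun M T Q1" "T_invariant_fun M T Q2"
    and eq: "\<And>A. A \<in> inv_sets M T \<Longrightarrow> Q1 A = Q2 A"
  shows "Q1 = Q2"
proof -
  interpret N1: prob_space "fun_measure M Q1" by (rule prob_space_fun_measure[OF Q1])
  interpret N2: prob_space "fun_measure M Q2" by (rule prob_space_fun_measure[OF Q2])
  define d where "d A = N1.prob A - N2.prob A" for A
  have Tn: "T ^^ n \<in> M \<rightarrow>\<^sub>M M" for n using measurable_compose_n[OF T] .
  obtain Y where Y: "Y \<in> sets M"
    and pos: "\<And>X. X \<in> sets M \<Longrightarrow> X \<subseteq> Y \<Longrightarrow> emeasure (fun_measure M Q2) X \<le> emeasure (fun_measure M Q1) X"
    and neg: "\<And>X. X \<in> sets M \<Longrightarrow> X \<inter> Y = {} \<Longrightarrow> emeasure (fun_measure M Q1) X \<le> emeasure (fun_measure M Q2) X"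
    using finite_unsigned_Hahn_decomposition[OF N1.finite_measure_axioms N2.finite_measure_axioms] by auto
  have d_split: "d A = d (A - B) + d (A \<inter> B)" if AB: "A \<in> sets M" "B \<in> sets M" for A B
  proof -
    have "(A - B) \<union> (A \<inter> B) = A" "(A - B) \<inter> (A \<inter> B) = {}" by auto
    then show ?thesis
      using AB N1.finite_measure_Union[of "A - B" "A \<inter> B"] N2.finite_measure_Union[of "A - B" "A \<inter> B"]
      by (simp add: d_def)
  qed
  have d_Un: "d (A \<union> B) + d (A \<inter> B) = d A + d B" if AB: "A \<in> sets M" "B \<in> sets M" for A B
  proof -
    have "d (A \<union> B) = d A + d (B - A)"
      using AB N1.finite_measure_Union'[of A B] N2.finite_measure_Union'[of A B] by (simp add: d_def)
    then show ?thesis using d_split[OF AB(2,1)] by (simp add: Int_commute)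
  qed
  \<comment> \<open>Passing from X to Y discards a part outside Y, where \<open>d\<close> is at most
    0, and adds a part of Y, where \<open>d\<close> is at least 0.\<close>
  have d_max: "d X \<le> d Y" if X: "X \<in> sets M" for X
  proof -
    have "d (X - Y) \<le> 0"
      using neg[of "X - Y"] X Y by (auto simp: d_def N1.emeasure_eq_measure N2.emeasure_eq_measure)
    moreover have "0 \<le> d (Y - X)"
      using pos[of "Y - X"] X Y by (auto simp: d_def N1.emeasure_eq_measure N2.emeasure_eq_measure)
    moreover have "d X = d (X - Y) + d (X \<inter> Y)" by (rule d_split[OF X Y])
    moreover have "d Y = d (Y - X) + d (X \<inter> Y)" using d_split[OF Y X] by (simp add: Int_commute)
    ultimately show ?thesis by linarith
  qed
  define Z where "Z n = (T ^^ n) -` Y \<inter> space M" for n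
  have Z: "Z n \<in> sets M" for n unfolding Z_def by (rule measurable_sets[OF Tn Y])
  have dZ: "d (Z n) = d Y" for n
  proof (induction n)
    case 0
    then show ?case using sets.sets_into_space[OF Y] by (simp add: Z_def Int_absorb2)
  next
    case (Suc n)
    have "Z (Suc n) = T -` Z n \<inter> space M"
      using measurable_space[OF T] by (auto simp: Z_def funpow_Suc_right simp del: funpow.simps)
    moreover have "d (T -` Z n \<inter> space M) = d (Z n)"
      using inv Z[of n] measurable_sets[OF T Z[of n]]
      by (simp add: d_def measure_fun_measure[OF Q1] measure_fun_measure[OF Q2] T_invariant_fun_def)
    ultimately show ?case using Suc by simp
  qed
  \<comment> \<open>\<open>d\<close> is modular, so its values on union and intersection add up to
    twice the maximum and neither can fall short. Maximising sets are closed under finite unions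
    and, by continuity, under monotone limits.\<close>
  have d_Un_max: "d (A \<union> B) = d Y" if AB: "A \<in> sets M" "B \<in> sets M" "d A = d Y" "d B = d Y" for A B
    using d_Un[OF AB(1,2)] d_max[of "A \<union> B"] d_max[of "A \<inter> B"] AB by (intro antisym) auto
  define U where "U n k = (\<Union>j\<le>k. Z (n + j))" for n k
  have U: "U n k \<in> sets M" for n k unfolding U_def using Z by auto
  have dU: "d (U n k) = d Y" for n k
  proof (induction k)
    case (Suc k)
    have "U n (Suc k) = U n k \<union> Z (n + Suc k)" by (auto simp: U_def atMost_Suc)
    then show ?case using d_Un_max[OF U Z Suc dZ] by simp
  qed (simp add: U_def dZ)
  define L where "L n = (\<Union>k. U n k)" for n
  have L: "L n \<in> sets M" for n unfolding L_def using U by auto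
  have dL: "d (L n) = d Y" for n
  proof (rule LIMSEQ_unique)
    have inc: "incseq (U n)" unfolding U_def by (intro incseq_SucI UN_mono) auto
    show "(\<lambda>k. d (U n k)) \<longlonglongrightarrow> d (L n)"
      unfolding d_def L_def using U inc
      by (intro tendsto_diff N1.finite_Lim_measure_incseq N2.finite_Lim_measure_incseq) auto
    show "(\<lambda>k. d (U n k)) \<longlonglongrightarrow> d Y" by (simp add: dU)
  qed
  define D where "D = (\<Inter>n. L n)"
  have L_iff: "x \<in> L n \<longleftrightarrow> (\<exists>j\<ge>n. x \<in> Z j)" for x n
    unfolding L_def U_def by (auto simp: le_iff_add)
  have D: "D \<in> sets M" unfolding D_def using L by auto
  have dD: "d D = d Y"
  proof (rule LIMSEQ_unique)
    have dec: "decseq L"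
    proof (rule decseq_SucI)
      show "L (Suc n) \<subseteq> L n" for n
      proof
        fix x assume "x \<in> L (Suc n)"
        then obtain j where "Suc n \<le> j" "x \<in> Z j" unfolding L_iff by blast
        then show "x \<in> L n" unfolding L_iff by (intro exI[of _ j]) simp
      qed
    qed
    show "(\<lambda>n. d (L n)) \<longlonglongrightarrow> d D"
      unfolding d_def D_def using L dec
      by (intro tendsto_diff N1.finite_Lim_measure_decseq N2.finite_Lim_measure_decseq) auto
    show "(\<lambda>n. d (L n)) \<longlonglongrightarrow> d Y" by (simp add: dL)
  qed
  have "T x \<in> D \<longleftrightarrow> x \<in> D" if x: "x \<in> space M" for x
  proof -
    have ZT: "T x \<in> Z j \<longleftrightarrow> x \<in> Z (Suc j)" for j
      using x measurable_space[OF T x] by (simp add: Z_def funpow_Suc_right del: funpow.simps)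
    have "(\<forall>n. \<exists>j\<ge>n. x \<in> Z (Suc j)) \<longleftrightarrow> (\<forall>n. \<exists>j\<ge>n. x \<in> Z j)"
    proof (intro iffI allI)
      fix n
      show "\<exists>j\<ge>n. x \<in> Z j" if *: "\<forall>n. \<exists>j\<ge>n. x \<in> Z (Suc j)"
      proof -
        obtain j where "n \<le> j" "x \<in> Z (Suc j)" using * by blast
        then show ?thesis by (intro exI[of _ "Suc j"]) simp
      qed
      show "\<exists>j\<ge>n. x \<in> Z (Suc j)" if *: "\<forall>n. \<exists>j\<ge>n. x \<in> Z j"
      proof -
        obtain j where "Suc n \<le> j" "x \<in> Z j" using * by blast
        then show ?thesis by (cases j) auto
      qed
    qed
    then show ?thesis by (simp add: D_def L_iff ZT)
  qed
  then have "D \<in> inv_sets M T"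
    using D sets.sets_into_space[OF D] by (auto simp: inv_sets_def)
  then have "d Y = 0"
    using eq[of D] D dD by (simp add: d_def measure_fun_measure[OF Q1] measure_fun_measure[OF Q2])
  \<comment> \<open>The maximum of \<open>d\<close> is 0, being attained on the invariant set
    \<open>D\<close>. Applied to complements as well, the resulting inequality between two
    probabilities becomes an equality.\<close>
  then have le: "Q1 A \<le> Q2 A" if "A \<in> sets M" for A
    using d_max[OF that] that by (simp add: d_def measure_fun_measure[OF Q1] measure_fun_measure[OF Q2])
  show ?thesis
  proof
    fix A
    show "Q1 A = Q2 A"
    proof (cases "A \<in> sets M")
      case True
      have "Q1 (space M - A) = 1 - Q1 A" "Q2 (space M - A) = 1 - Q2 A"
        using N1.prob_compl[of A] N2.prob_compl[of A] True
        by (simp_all add: measure_fun_measure[OF Q1] measure_fun_measure[OF Q2])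
      with le[OF True] le[of "space M - A"] True show ?thesis by simp
    next
      case False
      then show ?thesis using Q1 Q2 by (simp add: prob_fun_def)
    qed
  qed
qed

section \<open>Weak mixing of upper probabilities\<close>

text \<open>The indicator of an invariant set is an eigenfunction with eigenvalue 1, so it equals
  one constant \<open>k\<close> outside a set null for \<open>V\<close>. The same \<open>k\<close>
  serves the entire core and decides between mass 0 and mass 1.\<close>

lemma weakly_mixing_core_agree:
  assumes V: "upper_prob M V" and wm: "cap_weakly_mixing M T V"
    and P: "P \<in> core M V" and Q: "Q \<in> core M V" and A: "A \<in> inv_sets M T"
  shows "P A = Q A"
proof -
  have A_sets: "A \<in> sets M" and A_T: "\<And>x. x \<in> space M \<Longrightarrow> T x \<in> A \<longleftrightarrow> x \<in> A"
    using A by (auto simp: inv_sets_def)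
  define f :: "'a \<Rightarrow> complex" where "f = indicator A"
  have f [measurable]: "f \<in> borel_measurable M" unfolding f_def using A_sets by simp
  have "cap_ae M V (\<lambda>x. f (T x) = 1 * f x)"
    unfolding cap_ae_def using upper_prob_empty[OF V] A_T by (intro bexI[of _ "space M"]) (auto simp: f_def indicator_def)
  then obtain k where "cap_ae M V (\<lambda>x. f x = k)"
    using wm f unfolding cap_weakly_mixing_def by blast
  then have ae: "AE x in fun_measure M R. f x = k" if "R \<in> core M V" for R
    using that by (simp add: cap_ae_upper_prob_iff[OF V])
  have val: "R A = (if k = 1 then 1 else 0)" if R: "R \<in> core M V" for R
  proof -
    have pf: "prob_fun M R" by (rule core_prob_fun[OF V R])
    interpret prob_space "fun_measure M R" by (rule prob_space_fun_measure[OF pf])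
    have "prob A = (if k = 1 then 1 else 0)"
    proof (cases "k = 1")
      case True
      have "AE x in fun_measure M R. x \<in> A"
        using ae[OF R] by eventually_elim (auto simp: f_def True indicator_def split: if_splits)
      then show ?thesis using True A_sets by (simp add: prob_eq_1)
    next
      case False
      have "AE x in fun_measure M R. x \<notin> A"
        using ae[OF R] by eventually_elim (use False in \<open>auto simp: f_def indicator_def split: if_splits\<close>)
      then show ?thesis using False A_sets by (simp add: prob_eq_0)
    qed
    then show ?thesis using measure_fun_measure[OF pf A_sets] by simp
  qed
  show ?thesis using val[OF P] val[OF Q] by simp
qed

text \<open>An equation valid at every point holds almost surely for \<open>V\<close>, with the
  whole space as witness. This is why the criterion for ergodicity of the product was stated for
  such equations only.\<close>

lemma weakly_mixing_imp_Mwm: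
  assumes T: "T \<in> M \<rightarrow>\<^sub>M M" and V: "upper_prob M V" and wm: "cap_weakly_mixing M T V"
    and Q: "Q \<in> core M V" and Q_inv: "T_invariant_fun M T Q"
  shows "Q \<in> Mwm M T"
proof -
  have pf: "prob_fun M Q" by (rule core_prob_fun[OF V Q])
  interpret measure_preserving "fun_measure M Q" T
    by (rule measure_preserving_fun_measure[OF T pf Q_inv])
  let ?N = "fun_measure M Q"
  have eig: "\<exists>k. AE x in ?N. f x = k"
    if f: "f \<in> borel_measurable ?N" and fT: "\<And>x. x \<in> space ?N \<Longrightarrow> f (T x) = c * f x" for f :: "'a \<Rightarrow> complex" and c
  proof -
    have f' [measurable]: "f \<in> borel_measurable M" using f by (simp cong: measurable_cong_sets)
    have "cap_ae M V (\<lambda>x. f (T x) = c * f x)"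
      unfolding cap_ae_def using upper_prob_empty[OF V] fT by (intro bexI[of _ "space M"]) auto
    then obtain k where "cap_ae M V (\<lambda>x. f x = k)"
      using wm f' unfolding cap_weakly_mixing_def by blast
    then have "AE x in ?N. f x = k"
      using Q by (simp add: cap_ae_upper_prob_iff[OF V])
    then show ?thesis by blast
  qed
  have "measure (?N \<Otimes>\<^sub>M ?N) C = 0 \<or> measure (?N \<Otimes>\<^sub>M ?N) C = 1"
    if C: "C \<in> sets (?N \<Otimes>\<^sub>M ?N)" "map_prod T T -` C \<inter> space (?N \<Otimes>\<^sub>M ?N) = C" for C
  proof (rule product_ergodic_of_eigenfunctions_constant[OF eig C(1)])
    show "(T x, T y) \<in> C \<longleftrightarrow> (x, y) \<in> C" if "x \<in> space ?N" "y \<in> space ?N" for x y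
    proof -
      have "(x, y) \<in> map_prod T T -` C \<inter> space (?N \<Otimes>\<^sub>M ?N) \<longleftrightarrow> (x, y) \<in> C" by (simp only: C(2))
      then show ?thesis using that by (simp add: space_pair_measure)
    qed
  qed
  then show ?thesis using pf Q_inv by (simp add: Mwm_def Let_def)
qed

lemma Mwm_imp_weakly_mixing:
  assumes T: "T \<in> M \<rightarrow>\<^sub>M M" and V: "upper_prob M V" and V_inv: "T_invariant_fun M T V"
    and Q: "Q \<in> Mwm M T" "Q \<in> core M V"
    and agree: "\<And>P A. P \<in> core M V \<Longrightarrow> A \<in> inv_sets M T \<Longrightarrow> P A = Q A"
  shows "cap_weakly_mixing M T V"
  unfolding cap_weakly_mixing_def
proof (intro allI impI)
  fix f :: "'a \<Rightarrow> complex" and c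
  assume f [measurable]: "f \<in> borel_measurable M" and eig: "cap_ae M V (\<lambda>x. f (T x) = c * f x)"
  note [measurable] = T
  have Tn [measurable]: "(\<lambda>x. (T ^^ n) x) \<in> M \<rightarrow>\<^sub>M M" for n using measurable_compose_n[OF T] .
  have null_T: "V (T -` A \<inter> space M) = V A" if "A \<in> sets M" for A
    using V_inv that by (simp add: T_invariant_fun_def)
  have fk_sets: "{x \<in> space M. f x = k} \<in> sets M" for k by measurable
  show "\<exists>k. cap_ae M V (\<lambda>x. f x = k)"
  proof (cases "c = 0")
    \<comment> \<open>For \<open>c = 0\<close> the composition of f with T vanishes outside a set
      null for \<open>V\<close>; invariance of \<open>V\<close> moves this to f itself, and the
      constant is 0.\<close>
    case True
    obtain A where A: "A \<in> sets M" "V (space M - A) = 0" "\<forall>x\<in>A. f (T x) = c * f x"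
      using eig by (auto simp: cap_ae_def)
    have B: "space M - {x \<in> space M. f x = 0} \<in> sets M" using fk_sets[of 0] by auto
    define C where "C = T -` (space M - {x \<in> space M. f x = 0}) \<inter> space M"
    have C: "C \<in> sets M" unfolding C_def by (rule measurable_sets[OF T B])
    have C_sub: "C \<subseteq> space M - A" using A(3) True by (auto simp: C_def)
    have "P C = 0" if P: "P \<in> core M V" for P
    proof -
      have pf: "prob_fun M P" by (rule core_prob_fun[OF V P])
      interpret prob_space "fun_measure M P" by (rule prob_space_fun_measure[OF pf])
      have "prob (space M - A) = 0"
        using A(1,2) P upper_prob_null_iff[OF V, of "space M - A"] by (auto simp: measure_fun_measure[OF pf])
      moreover have "prob C \<le> prob (space M - A)" using C_sub A(1) by (intro finite_measure_mono) auto
      ultimately have "prob C = 0" by (simp add: measure_le_0_iff)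
      then show ?thesis using measure_fun_measure[OF pf C] by simp
    qed
    then have "V C = 0" by (simp add: upper_prob_null_iff[OF V C])
    then have "V (space M - {x \<in> space M. f x = 0}) = 0" using null_T[OF B] by (simp add: C_def)
    then show ?thesis
      unfolding cap_ae_def using fk_sets[of 0] by (intro exI[of _ 0] bexI[of _ "{x \<in> space M. f x = 0}"]) auto
  next
    case False
    have pfQ: "prob_fun M Q" and Q_inv: "T_invariant_fun M T Q" using Q(1) by (auto simp: Mwm_def)
    interpret Q: measure_preserving "fun_measure M Q" T
      by (rule measure_preserving_fun_measure[OF T pfQ Q_inv])
    have eig_sets: "{x \<in> space M. f (T ((T ^^ n) x)) = c * f ((T ^^ n) x)} \<in> sets M" for n by measurable
    have eig_ae: "AE x in fun_measure M P. \<forall>n. f ((T ^^ n) x) = c ^ n * f x" if P: "P \<in> core M V" for P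
    proof -
      \<comment> \<open>The set where the equation fails at time n is pulled back by T. Invariance
        of \<open>V\<close> keeps it null, although \<open>P\<close> need not be invariant.\<close>
      have "cap_ae M V (\<lambda>x. f (T ((T ^^ n) x)) = c * f ((T ^^ n) x))" for n
      proof (induction n)
        case (Suc n)
        define B where "B = {x \<in> space M. f (T ((T ^^ n) x)) = c * f ((T ^^ n) x)}"
        have B: "B \<in> sets M" unfolding B_def by (rule eig_sets)
        have "V (space M - B) = 0"
        proof -
          have "V (space M - B) = 0 \<longleftrightarrow> (\<forall>P\<in>core M V. P (space M - B) = 0)"
            using B by (intro upper_prob_null_iff[OF V]) auto
          moreover have "P (space M - B) = 0" if P: "P \<in> core M V" for P
          proof -
            have pf: "prob_fun M P" by (rule core_prob_fun[OF V P])
            interpret prob_space "fun_measure M P" by (rule prob_space_fun_measure[OF pf])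
            have "AE x in fun_measure M P. f (T ((T ^^ n) x)) = c * f ((T ^^ n) x)"
              using Suc P by (simp add: cap_ae_upper_prob_iff[OF V eig_sets])
            then have "AE x in fun_measure M P. x \<in> B"
              using AE_space by eventually_elim (simp add: B_def)
            then have "prob B = 1" using B by (simp add: prob_eq_1)
            then show ?thesis using prob_compl[of B] B by (simp add: measure_fun_measure[OF pf])
          qed
          ultimately show ?thesis by blast
        qed
        then have "V (T -` (space M - B) \<inter> space M) = 0" using null_T[of "space M - B"] B by simp
        moreover have "T -` (space M - B) \<inter> space M = space M - (T -` B \<inter> space M)"
          using measurable_space[OF T] by auto
        ultimately show ?case
          unfolding cap_ae_def using measurable_sets[OF T B]
          by (intro bexI[of _ "T -` B \<inter> space M"]) (auto simp: B_def funpow_swap1)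
      qed (use eig in simp)
      then have "AE x in fun_measure M P. f (T ((T ^^ n) x)) = c * f ((T ^^ n) x)" for n
        using P by (simp add: cap_ae_upper_prob_iff[OF V eig_sets])
      then have "AE x in fun_measure M P. \<forall>n. f (T ((T ^^ n) x)) = c * f ((T ^^ n) x)"
        by (simp add: AE_all_countable)
      then show ?thesis
      proof eventually_elim
        fix x assume *: "\<forall>n. f (T ((T ^^ n) x)) = c * f ((T ^^ n) x)"
        show "\<forall>n. f ((T ^^ n) x) = c ^ n * f x"
        proof
          fix n show "f ((T ^^ n) x) = c ^ n * f x" using * by (induction n) auto
        qed
      qed
    qed
    have Q_eig: "AE x in fun_measure M Q. f (T x) = c * f x"
      using eig_ae[OF Q(2)]
    proof eventually_elim
      fix x assume "\<forall>n. f ((T ^^ n) x) = c ^ n * f x"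
      from this[rule_format, of 1] show "f (T x) = c * f x" by simp
    qed
    have "\<exists>k. AE x in fun_measure M Q. f x = k"
    proof (rule Q.eigenfunction_constant_of_product_ergodic[OF _ _ Q_eig False])
      show "f \<in> borel_measurable (fun_measure M Q)" using f by (simp cong: measurable_cong_sets)
    qed (use Q(1) in \<open>simp add: Mwm_def Let_def\<close>)
    then obtain k where k: "AE x in fun_measure M Q. f x = k" by blast
    \<comment> \<open>Either alternative ensures, as \<open>c \<noteq> 0\<close>, that the value
      \<open>k\<close> at some time of the orbit forces the value \<open>k\<close> at its start:
      \<open>c ^ N * f x = k\<close> gives \<open>f x = k\<close>.\<close>
    have ck: "c = 1 \<or> k = 0"
    proof -
      have "AE x in fun_measure M Q. k = c * k"
        using k Q.AE_T[OF k] Q_eig by eventually_elim simp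
      then show ?thesis by auto
    qed
    define K where "K = {x \<in> space M. \<exists>N. \<forall>n\<ge>N. f ((T ^^ n) x) = k}"
    have K: "K \<in> sets M" unfolding K_def by measurable
    have "T x \<in> K \<longleftrightarrow> x \<in> K" if x: "x \<in> space M" for x
    proof -
      have "(\<exists>N. \<forall>n\<ge>N. f ((T ^^ Suc n) x) = k) \<longleftrightarrow> (\<exists>N. \<forall>n\<ge>N. f ((T ^^ n) x) = k)"
        using eventually_sequentially_Suc[of "\<lambda>n. f ((T ^^ n) x) = k"] by (simp only: eventually_sequentially)
      then show ?thesis
        using x measurable_space[OF T x] by (simp add: K_def funpow_Suc_right del: funpow.simps)
    qed
    then have K_inv: "K \<in> inv_sets M T"
      using K sets.sets_into_space[OF K] by (auto simp: inv_sets_def)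
    have "AE x in fun_measure M Q. x \<in> K"
      using Q.AE_T_all[OF k] AE_space by eventually_elim (simp add: K_def)
    then have "Q.prob K = 1" using K by (simp add: Q.prob_eq_1)
    then have QK: "Q K = 1" by (simp add: measure_fun_measure[OF pfQ K])
    have "AE x in fun_measure M P. f x = k" if P: "P \<in> core M V" for P
    proof -
      have pf: "prob_fun M P" by (rule core_prob_fun[OF V P])
      interpret prob_space "fun_measure M P" by (rule prob_space_fun_measure[OF pf])
      have "prob K = 1" using agree[OF P K_inv] QK measure_fun_measure[OF pf K] by simp
      then have "AE x in fun_measure M P. x \<in> K" using K by (simp add: prob_eq_1)
      then show ?thesis using eig_ae[OF P]
      proof eventually_elim
        fix x assume "x \<in> K" and *: "\<forall>n. f ((T ^^ n) x) = c ^ n * f x"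
        then obtain N where "f ((T ^^ N) x) = k" by (auto simp: K_def)
        then have "c ^ N * f x = k" using * by simp
        then show "f x = k" using ck False by auto
      qed
    qed
    then show ?thesis using fk_sets[of k] by (auto simp: cap_ae_upper_prob_iff[OF V])
  qed
qed

theorem lemma5p3:
  fixes M :: "'a measure" and T :: "'a \<Rightarrow> 'a" and V :: "'a set \<Rightarrow> real"
  assumes "T \<in> M \<rightarrow>\<^sub>M M"
    and "upper_prob M V"
    and "T_invariant_fun M T V"
  shows "(cap_weakly_mixing M T V \<longleftrightarrow>
            (\<exists>Q\<in>Mwm M T \<inter> core M V. \<forall>P\<in>core M V. \<forall>A\<in>inv_sets M T. P A = Q A))
       \<and> (\<forall>Q1 Q2. Q1 \<in> Mwm M T \<inter> core M V \<longrightarrow> (\<forall>P\<in>core M V. \<forall>A\<in>inv_sets M T. P A = Q1 A)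
            \<longrightarrow> Q2 \<in> Mwm M T \<inter> core M V \<longrightarrow> (\<forall>P\<in>core M V. \<forall>A\<in>inv_sets M T. P A = Q2 A)
            \<longrightarrow> Q1 = Q2)"
proof (intro conjI allI impI iffI)
  assume wm: "cap_weakly_mixing M T V"
  obtain P0 where P0: "P0 \<in> core M V"
    by (rule upper_prob_attained[OF assms(2) sets.empty_sets]) blast
  have V_le: "V A \<le> 1" if A: "A \<in> sets M" for A
  proof -
    obtain P where P: "P \<in> core M V" "P A = V A" by (rule upper_prob_attained[OF assms(2) A]) blast
    have pf: "prob_fun M P" by (rule core_prob_fun[OF assms(2) P(1)])
    interpret prob_space "fun_measure M P" by (rule prob_space_fun_measure[OF pf])
    show ?thesis using prob_le_1[of A] measure_fun_measure[OF pf A] P(2) by simp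
  qed
  obtain Q where Q: "Q \<in> core M V" "T_invariant_fun M T Q"
    by (rule invariant_core_exists[OF assms(1,3) P0 V_le]) blast+
  have "Q \<in> Mwm M T" by (rule weakly_mixing_imp_Mwm[OF assms(1,2) wm Q])
  moreover have "P A = Q A" if "P \<in> core M V" "A \<in> inv_sets M T" for P A
    by (rule weakly_mixing_core_agree[OF assms(2) wm that(1) Q(1) that(2)])
  ultimately show "\<exists>Q\<in>Mwm M T \<inter> core M V. \<forall>P\<in>core M V. \<forall>A\<in>inv_sets M T. P A = Q A"
    using Q(1) by blast
next
  assume "\<exists>Q\<in>Mwm M T \<inter> core M V. \<forall>P\<in>core M V. \<forall>A\<in>inv_sets M T. P A = Q A"
  then obtain Q where "Q \<in> Mwm M T" "Q \<in> core M V"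
    "\<And>P A. P \<in> core M V \<Longrightarrow> A \<in> inv_sets M T \<Longrightarrow> P A = Q A" by blast
  then show "cap_weakly_mixing M T V" by (rule Mwm_imp_weakly_mixing[OF assms])
next
  fix Q1 Q2
  assume "Q1 \<in> Mwm M T \<inter> core M V" "Q2 \<in> Mwm M T \<inter> core M V"
    "\<forall>P\<in>core M V. \<forall>A\<in>inv_sets M T. P A = Q2 A"
  \<comment> \<open>Agreement on invariant sets is the property of \<open>Q2\<close> applied to the
    member \<open>Q1\<close> of the core.\<close>
  then show "Q1 = Q2"
    by (intro invariant_prob_fun_eqI[OF assms(1)]) (auto simp: Mwm_def)
qed

end
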